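(* For any $x\in[0,1]^n$, let $S=\{i\in[n]:x_i\neq0\}$ be the set of indices of nonzero entries of $x$ and $S^C=[n]\setminus S$ its complement. For $y\in\mathbb{R}^n$, $\lambda\in\mathbb{R}^{m_1}$ and $\mu\in\mathbb{R}^{m_2}$, let $y_i=0$ for $i\in S^C$ and let $y_S,\lambda,\mu$ be the primal-dual optimal solution of the following quadratic program in the reduced space indexed by $S$: $$\min_{\tilde y\in\mathbb{R}^{|S|}}\ \ \tilde y^\top\Big(R_S+\mathrm{diag}\big(\{\delta_i/x_i\}_{i\in S}\big)\Big)\tilde y+g_S^\top\tilde y\quad\text{s.t.}\quad A_S\tilde y\le b,\quad C_S\tilde y\le Dx,$$ where $\lambda$ is the multiplier vector of the first group of constraints and $\mu$ that of the second. Then $t\in\partial\bar f_{\mathrm{persp}}(x)$ if and only if there exists $\Psi\in\mathbb{R}^{|S^C|}$ (indexed by $S^C$) such that $$t_i=-\delta_i\frac{y_i^2}{x_i^2}-\mu^\top D_i+h_i\quad\forall i\in S,$$ $$\delta_i\Psi_i=-(2R_i^\top y+g_i+\lambda^\top A_i+\mu^\top C_i)\quad\forall i\in S^C,$$ $$t_i\le-\tfrac14\delta_i\Psi_i^2-\mu^\top D_i+h_i\quad\forall i\in S^C.$$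
   Context: Problem data: $Q\in\mathbb{R}^{n\times n}$ positive definite, $g,h\in\mathbb{R}^n$, $A\in\mathbb{R}^{m_1\times n}$, $b\in\mathbb{R}^{m_1}$, $C,D\in\mathbb{R}^{m_2\times n}$, $X\subseteq\{0,1\}^n$. (MIQP) is: minimize $y^\top Qy+g^\top y+h^\top x$ over $(x,y)$ subject to $Ay\le b$, $Cy\le Dx$, $y_i(1-x_i)=0$ for $i=1,\dots,n$, $x\in X$. Standing assumption: (MIQP) has a feasible point $(\tilde x,\tilde y)$. Decomposition: $Q=\mathrm{diag}(\delta)+R$ with $\delta\in\mathbb{R}^n$, $\delta\ge0$, and $R$ positive semidefinite. The function $y_i^2/x_i$ is understood as the closed perspective function: it equals $y_i^2/x_i$ if $x_i>0$, $0$ if $x_i=y_i=0$, and $+\infty$ otherwise. Let $F_1=\{y:Ay\le b\}$, $F_2=\{(x,y):Cy\le Dx\}$, and let $\mathcal I_{\mathcal C}$ be the indicator function of a set $\mathcal C$ ($0$ on $\mathcal C$, $+\infty$ off it). Define $$f_{\mathrm{persp}}(x,y)=y^\top Ry+\sum_{i=1}^n\delta_i\frac{y_i^2}{x_i}+g^\top y+h^\top x+\mathcal I_{F_1}(y)+\mathcal I_{F_2}(x,y),\qquad\bar f_{\mathrm{persp}}(x)=\inf_{y\in\mathbb{R}^n}f_{\mathrm{persp}}(x,y).$$ $\partial$ denotes the convex subdifferential. Notation: for a matrix $H$, $H_i$ is its $i$th column; $A_S,C_S$ are the submatrices of columns indexed by $S$; $R_S$ is the principal submatrix indexed by $S$;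 $g_S,y_S$ are the subvectors indexed by $S$.
   Formalization: The "iff" is shown when the primal-dual optimal solution is unique; otherwise "if" holds for each, and "iff" with some optimal λ, μ provided, for each i with δ_i=0, x_i>0 occurs in the domain of f̄. Terms with δ_i=0 keep the domain of y_i²/x_i. For a fixed non-unique μ "only if" fails. *)

theory Defs
  imports "HOL-Analysis.Analysis"
begin

definition pos_definite :: "real^'n^'n \<Rightarrow> bool" where
  "pos_definite M \<longleftrightarrow> transpose M = M \<and> (\<forall>v. v \<noteq> 0 \<longrightarrow> v \<bullet> (M *v v) > 0)"

definition pos_semidefinite :: "real^'n^'n \<Rightarrow> bool" where
  "pos_semidefinite M \<longleftrightarrow> transpose M = M \<and> (\<forall>v. v \<bullet> (M *v v) \<ge> 0)"

definition diag_mat :: "real^'n \<Rightarrow> real^'n^'n" where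
  "diag_mat d = (\<chi> i j. if i = j then d $ i else 0)"

definition supp :: "real^'n \<Rightarrow> 'n set" where
  "supp x = {i. x $ i \<noteq> 0}"

text \<open>The order on vectors is the componentwise one.\<close>

definition F1 :: "real^'n^'m1 \<Rightarrow> real^'m1 \<Rightarrow> (real^'n) set" where
  "F1 A b = {y. A *v y \<le> b}"

definition F2 :: "real^'n^'m2 \<Rightarrow> real^'n^'m2 \<Rightarrow> ((real^'n) \<times> (real^'n)) set" where
  "F2 C D = {(x, y). C *v y \<le> D *v x}"

definition miqp_feasible ::
  "real^'n^'m1 \<Rightarrow> real^'m1 \<Rightarrow> real^'n^'m2 \<Rightarrow> real^'n^'m2 \<Rightarrow> (real^'n) set
    \<Rightarrow> real^'n \<Rightarrow> real^'n \<Rightarrow> bool" where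
  "miqp_feasible A b C D X x y \<longleftrightarrow>
     y \<in> F1 A b \<and> (x, y) \<in> F2 C D \<and> (\<forall>i. y $ i * (1 - x $ i) = 0) \<and> x \<in> X"

definition indicator_fun :: "'a set \<Rightarrow> 'a \<Rightarrow> ereal" where
  "indicator_fun K z = (if z \<in> K then 0 else \<infinity>)"

definition persp :: "real \<Rightarrow> real \<Rightarrow> ereal" where
  "persp y x = (if x > 0 then ereal (y\<^sup>2 / x) else if x = 0 \<and> y = 0 then 0 else \<infinity>)"

text \<open>Multiplication by a coefficient \<open>d \<ge> 0\<close> that keeps the domain, i.e. with
  \<open>0 \<cdot> \<infinity> = \<infinity>\<close> (the product on \<^typ>\<open>ereal\<close> has \<open>0 * \<infinity> = 0\<close>).  So a term
  with coefficient 0 still forces \<open>x\<^sub>i \<ge> 0\<close>, and \<open>y\<^sub>i = 0\<close> whenever \<open>x\<^sub>i = 0\<close>.\<close>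

definition dom_scale :: "real \<Rightarrow> ereal \<Rightarrow> ereal" where
  "dom_scale d e = (if e = \<infinity> then \<infinity> else ereal d * e)"

definition f_persp ::
  "real^'n^'n \<Rightarrow> real^'n \<Rightarrow> real^'n \<Rightarrow> real^'n \<Rightarrow> real^'n^'m1 \<Rightarrow> real^'m1
    \<Rightarrow> real^'n^'m2 \<Rightarrow> real^'n^'m2 \<Rightarrow> real^'n \<Rightarrow> real^'n \<Rightarrow> ereal" where
  "f_persp R \<delta> g h A b C D x y =
     ereal (y \<bullet> (R *v y)) + (\<Sum>i\<in>UNIV. dom_scale (\<delta> $ i) (persp (y $ i) (x $ i)))
     + ereal (g \<bullet> y) + ereal (h \<bullet> x)
     + indicator_fun (F1 A b) y + indicator_fun (F2 C D) (x, y)"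

definition fbar_persp ::
  "real^'n^'n \<Rightarrow> real^'n \<Rightarrow> real^'n \<Rightarrow> real^'n \<Rightarrow> real^'n^'m1 \<Rightarrow> real^'m1
    \<Rightarrow> real^'n^'m2 \<Rightarrow> real^'n^'m2 \<Rightarrow> real^'n \<Rightarrow> ereal" where
  "fbar_persp R \<delta> g h A b C D x = (INF y. f_persp R \<delta> g h A b C D x y)"

text \<open>For a function with a finite value somewhere, the subdifferential is empty
  at points where the function is \<open>\<infinity>\<close>.\<close>

definition subdifferential :: "('a::real_inner \<Rightarrow> ereal) \<Rightarrow> 'a \<Rightarrow> 'a set" where
  "subdifferential f x = {t. \<forall>z. f z \<ge> f x + ereal (t \<bullet> (z - x))}"

text \<open>The reduced quadratic program.  A vector indexed by \<open>S\<close> is represented by a vector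
  of the full space of which only the entries in \<open>S\<close> are read; \<open>sub_mv S M v\<close>
  is \<open>M\<^sub>S v\<^sub>S\<close>.\<close>

definition sub_mv :: "'n set \<Rightarrow> real^'n^'m \<Rightarrow> real^'n \<Rightarrow> real^'m" where
  "sub_mv S M v = (\<chi> k. \<Sum>j\<in>S. M $ k $ j * v $ j)"

definition red_obj ::
  "real^'n^'n \<Rightarrow> real^'n \<Rightarrow> real^'n \<Rightarrow> real^'n \<Rightarrow> real^'n \<Rightarrow> real" where
  "red_obj R \<delta> g x v =
     (\<Sum>i\<in>supp x. \<Sum>j\<in>supp x.
        v $ i * (R $ i $ j + (if i = j then \<delta> $ i / x $ i else 0)) * v $ j)
     + (\<Sum>i\<in>supp x. g $ i * v $ i)"

definition red_feasible ::
  "real^'n^'m1 \<Rightarrow> real^'m1 \<Rightarrow> real^'n^'m2 \<Rightarrow> real^'n^'m2 \<Rightarrow> real^'n \<Rightarrow> real^'n \<Rightarrow> bool" where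
  "red_feasible A b C D x v \<longleftrightarrow>
     sub_mv (supp x) A v \<le> b \<and> sub_mv (supp x) C v \<le> D *v x"

definition red_lagrangian ::
  "real^'n^'n \<Rightarrow> real^'n \<Rightarrow> real^'n \<Rightarrow> real^'n^'m1 \<Rightarrow> real^'m1 \<Rightarrow> real^'n^'m2 \<Rightarrow> real^'n^'m2
    \<Rightarrow> real^'n \<Rightarrow> real^'n \<Rightarrow> real^'m1 \<Rightarrow> real^'m2 \<Rightarrow> real" where
  "red_lagrangian R \<delta> g A b C D x v l m =
     red_obj R \<delta> g x v + l \<bullet> (sub_mv (supp x) A v - b) + m \<bullet> (sub_mv (supp x) C v - D *v x)"

definition red_dual ::
  "real^'n^'n \<Rightarrow> real^'n \<Rightarrow> real^'n \<Rightarrow> real^'n^'m1 \<Rightarrow> real^'m1 \<Rightarrow> real^'n^'m2 \<Rightarrow> real^'n^'m2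
    \<Rightarrow> real^'n \<Rightarrow> real^'m1 \<Rightarrow> real^'m2 \<Rightarrow> ereal" where
  "red_dual R \<delta> g A b C D x l m = (INF v. ereal (red_lagrangian R \<delta> g A b C D x v l m))"

text \<open>\<open>y\<close> is zero outside the support of \<open>x\<close>, its entries in the support solve the
  reduced program, and \<open>(l, m)\<close> solves the Lagrangian dual of the reduced program.\<close>

definition primal_dual_optimal ::
  "real^'n^'n \<Rightarrow> real^'n \<Rightarrow> real^'n \<Rightarrow> real^'n^'m1 \<Rightarrow> real^'m1 \<Rightarrow> real^'n^'m2 \<Rightarrow> real^'n^'m2
    \<Rightarrow> real^'n \<Rightarrow> real^'n \<Rightarrow> real^'m1 \<Rightarrow> real^'m2 \<Rightarrow> bool" where
  "primal_dual_optimal R \<delta> g A b C D x y l m \<longleftrightarrow>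
     (\<forall>i. i \<notin> supp x \<longrightarrow> y $ i = 0)
     \<and> red_feasible A b C D x y
     \<and> (\<forall>v. red_feasible A b C D x v \<longrightarrow> red_obj R \<delta> g x y \<le> red_obj R \<delta> g x v)
     \<and> 0 \<le> l \<and> 0 \<le> m
     \<and> (\<forall>l' m'. 0 \<le> l' \<and> 0 \<le> m' \<longrightarrow>
          red_dual R \<delta> g A b C D x l' m' \<le> red_dual R \<delta> g A b C D x l m)"

text \<open>Only the entries of \<open>\<Psi>\<close> outside the support of \<open>x\<close> are read.\<close>

definition subgradient_system ::
  "real^'n^'n \<Rightarrow> real^'n \<Rightarrow> real^'n \<Rightarrow> real^'n \<Rightarrow> real^'n^'m1 \<Rightarrow> real^'n^'m2 \<Rightarrow> real^'n^'m2
    \<Rightarrow> real^'n \<Rightarrow> real^'n \<Rightarrow> real^'m1 \<Rightarrow> real^'m2 \<Rightarrow> real^'n \<Rightarrow> real^'n \<Rightarrow> bool" where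
  "subgradient_system R \<delta> g h A C D x y l m t \<Psi> \<longleftrightarrow>
     (\<forall>i\<in>supp x. t $ i = - \<delta> $ i * (y $ i)\<^sup>2 / (x $ i)\<^sup>2 - m \<bullet> column i D + h $ i)
     \<and> (\<forall>i\<in>- supp x. \<delta> $ i * \<Psi> $ i =
          - (2 * (column i R \<bullet> y) + g $ i + l \<bullet> column i A + m \<bullet> column i C))
     \<and> (\<forall>i\<in>- supp x. t $ i \<le> - (1 / 4) * \<delta> $ i * (\<Psi> $ i)\<^sup>2 - m \<bullet> column i D + h $ i)"

end

(*
  For feasible points f_persp is the real function val, and t is a subgradient of the partial
  infimum at x iff for a minimiser y of f_persp(x, .) the pair (x, y) minimises val - t.z jointly
  in (z, w).  At an index with x_i = 0 the perspective term is its own directional derivative, so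
  joint optimality says that a linear functional plus a sum of perspectives is nonnegative on a
  polyhedral cone.  A Farkas theorem for such sums produces the multipliers, and the slopes of
  the perspective terms give the inequality for t_i and the numbers Psi_i.  If no feasible
  direction makes some denominators positive, facial reduction is needed; it works for
  delta_i > 0, whereas for delta_i = 0 the qualification of the last part is used.
  Uniqueness of the multipliers implies that qualification, by Gordan's alternative.
  Conversely, the system provides an affine minorant of val that is exact at (x, y).
*)

theory Submission
  imports Defs
begin

section \<open>A Farkas theorem for sums of perspectives\<close>

text \<open>For p > 0 the term d q^2 / p is the maximum of -(\<beta> p + a q) over all pairs with 0
  \<le> \<beta> and a^2 \<le> 4 d \<beta>. Nonnegativity on a polyhedral cone should therefore place
  the linear functional in the difference of a sum of such parabolic sets and the cone spanned by
  the constraints. The obstacle is closedness: this difference need not be closed, and separation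
  would then reach only its closure. A direction with positive denominators bounds the slopes and
  restores closedness. Where none exists, the condition "q = 0 whenever p = 0" acts as an equation
  whose multiplier on q has free sign and size. A pair (\<beta>, a) can imitate it with a large
  \<beta> when d > 0, but for d = 0 only a = 0 is allowed. The reduced program keeps x fixed and
  never sees these indices, so its multipliers come from the linear Farkas lemma alone.\<close>

lemma convex_cone_hull_image_sum:
  assumes "finite I" "r \<in> convex_cone hull (f ` I)"
  obtains \<nu> where "\<And>i. 0 \<le> \<nu> i" "r = (\<Sum>i\<in>I. \<nu> i *\<^sub>R f i)"
proof -
  \<comment> \<open>Coefficients belong to indices rather than to vectors, so that equal constraint
    rows keep separate multipliers.\<close>
  let ?C = "{\<Sum>i\<in>I. \<nu> i *\<^sub>R f i |\<nu>. \<forall>i. (0::real) \<le> \<nu> i}"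
  have "convex_cone ?C"
    unfolding convex_cone_iff
  proof (intro conjI ballI allI impI)
    show "0 \<in> ?C" by (rule CollectI, rule exI[of _ "\<lambda>_. 0"]) simp
  next
    fix x y assume "x \<in> ?C" "y \<in> ?C"
    then obtain \<nu> \<mu> where "\<forall>i. 0 \<le> \<nu> i" "\<forall>i. 0 \<le> \<mu> i"
      "x = (\<Sum>i\<in>I. \<nu> i *\<^sub>R f i)" "y = (\<Sum>i\<in>I. \<mu> i *\<^sub>R f i)" by blast
    then show "x + y \<in> ?C"
      by (intro CollectI exI[of _ "\<lambda>i. \<nu> i + \<mu> i"]) (simp add: scaleR_left_distrib sum.distrib)
  next
    fix x and k :: real assume "x \<in> ?C" "0 \<le> k"
    then obtain \<nu> where "\<forall>i. 0 \<le> \<nu> i" "x = (\<Sum>i\<in>I. \<nu> i *\<^sub>R f i)" by blast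
    with \<open>0 \<le> k\<close> show "k *\<^sub>R x \<in> ?C"
      by (intro CollectI exI[of _ "\<lambda>i. k * \<nu> i"]) (simp add: scaleR_sum_right)
  qed
  moreover have "f i \<in> ?C" if "i \<in> I" for i
  proof -
    have "f i = (\<Sum>j\<in>I. (if j = i then 1 else 0) *\<^sub>R f j)"
      using that assms(1) by (simp add: if_distrib[of "\<lambda>t. t *\<^sub>R _"] cong: if_cong)
    then show ?thesis
      by (intro CollectI exI[of _ "\<lambda>j. if j = i then 1 else 0"]) simp
  qed
  then have "f ` I \<subseteq> ?C" by blast
  ultimately have "r \<in> ?C" using assms(2) hull_minimal[of _ ?C convex_cone] by blast
  then show thesis using that by blast
qed

section \<open>Perspectives as support functions of parabolic sets\<close>

lemma perspective_lower_bound: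
  fixes a \<beta> d p q :: real
  assumes "0 \<le> \<beta>" "a\<^sup>2 \<le> 4 * d * \<beta>" "0 \<le> d" "0 < p"
  shows "- d * q\<^sup>2 / p \<le> \<beta> * p + a * q"
proof (cases "d = 0")
  case True
  then show ?thesis using assms by simp
next
  case False
  with assms have d: "0 < d" by simp
  have "a\<^sup>2 * p\<^sup>2 \<le> 4 * d * \<beta> * p\<^sup>2"
    by (intro mult_right_mono) (use assms in auto)
  \<comment> \<open>By the bound on the square of \<open>a\<close>, this square is at most 4 d times
    the quadratic whose sign is wanted.\<close>
  moreover have "0 \<le> (a * p + 2 * d * q)\<^sup>2" by simp
  ultimately have "0 \<le> 4 * d * (\<beta> * p\<^sup>2 + a * q * p + d * q\<^sup>2)"
    by (simp add: power2_eq_square algebra_simps)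
  then have "0 \<le> \<beta> * p\<^sup>2 + a * q * p + d * q\<^sup>2"
    using d by (simp add: zero_le_mult_iff)
  then show ?thesis
    using \<open>0 < p\<close> by (simp add: field_simps power2_eq_square)
qed

text \<open>\<open>B\<close> is a parameter so that the parabolic sets and their compact truncations
  are treated alike.\<close>

definition persp_slopes ::
  "'i set \<Rightarrow> ('i \<Rightarrow> 'a::real_vector) \<Rightarrow> ('i \<Rightarrow> 'a) \<Rightarrow> ('i \<Rightarrow> (real \<times> real) set) \<Rightarrow> 'a set" where
  "persp_slopes N P Q B =
     {(\<Sum>i\<in>N. fst (s i) *\<^sub>R P i + snd (s i) *\<^sub>R Q i) |s. \<forall>i\<in>N. s i \<in> B i}"

lemma persp_slopes_insert:
  assumes "finite N" "i \<notin> N"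
  shows "persp_slopes (insert i N) P Q B =
    (\<Union>u\<in>(\<lambda>z. fst z *\<^sub>R P i + snd z *\<^sub>R Q i) ` B i. \<Union>v\<in>persp_slopes N P Q B. {u + v})"
    (is "?L = ?R")
proof
  show "?L \<subseteq> ?R"
    using assms by (fastforce simp: persp_slopes_def)
  show "?R \<subseteq> ?L"
  proof clarsimp
    fix \<beta> a v assume z: "(\<beta>, a) \<in> B i" and "v \<in> persp_slopes N P Q B"
    then obtain s where s: "\<forall>j\<in>N. s j \<in> B j"
      and v: "v = (\<Sum>j\<in>N. fst (s j) *\<^sub>R P j + snd (s j) *\<^sub>R Q j)"
      by (auto simp: persp_slopes_def)
    let ?s = "s(i := (\<beta>, a))"
    have "v = (\<Sum>j\<in>N. fst (?s j) *\<^sub>R P j + snd (?s j) *\<^sub>R Q j)"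
      unfolding v using assms by (intro sum.cong) auto
    then have "\<beta> *\<^sub>R P i + a *\<^sub>R Q i + v
        = (\<Sum>j\<in>insert i N. fst (?s j) *\<^sub>R P j + snd (?s j) *\<^sub>R Q j)"
      using assms by simp
    moreover have "\<forall>j\<in>insert i N. ?s j \<in> B j" using s z by auto
    ultimately show "\<beta> *\<^sub>R P i + a *\<^sub>R Q i + v \<in> persp_slopes (insert i N) P Q B"
      unfolding persp_slopes_def by blast
  qed
qed

lemma compact_persp_slopes:
  fixes P Q :: "'i \<Rightarrow> 'a::euclidean_space"
  assumes "finite N" "\<And>i. i \<in> N \<Longrightarrow> compact (B i)"
  shows "compact (persp_slopes N P Q B)"
  using assms
proof (induction N rule: finite_induct)
  case empty
  then show ?case by (simp add: persp_slopes_def)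
next
  case (insert i N)
  have "compact ((\<lambda>z. fst z *\<^sub>R P i + snd z *\<^sub>R Q i) ` B i)"
    by (intro compact_continuous_image continuous_intros) (use insert.prems in auto)
  moreover have "compact (persp_slopes N P Q B)" using insert by auto
  ultimately have "compact {u + v |u v. u \<in> (\<lambda>z. fst z *\<^sub>R P i + snd z *\<^sub>R Q i) ` B i
      \<and> v \<in> persp_slopes N P Q B}"
    by (rule compact_sums)
  moreover have "{u + v |u v. u \<in> (\<lambda>z. fst z *\<^sub>R P i + snd z *\<^sub>R Q i) ` B i
      \<and> v \<in> persp_slopes N P Q B} = persp_slopes (insert i N) P Q B"
    unfolding persp_slopes_insert[OF insert.hyps(1,2)] by blast
  ultimately show ?case by simp
qed

lemma convex_persp_slopes:
  fixes P Q :: "'i \<Rightarrow> 'a::euclidean_space"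
  assumes "finite N" "\<And>i. i \<in> N \<Longrightarrow> convex (B i)"
  shows "convex (persp_slopes N P Q B)"
  using assms
proof (induction N rule: finite_induct)
  case empty
  then show ?case by (simp add: persp_slopes_def)
next
  case (insert i N)
  have "linear (\<lambda>z. fst z *\<^sub>R P i + snd z *\<^sub>R Q i)"
    by (rule linearI) (auto simp: algebra_simps)
  then have "convex ((\<lambda>z. fst z *\<^sub>R P i + snd z *\<^sub>R Q i) ` B i)"
    by (rule convex_linear_image) (use insert.prems in auto)
  then show ?case
    unfolding persp_slopes_insert[OF insert.hyps(1,2)]
    using insert by (intro convex_sums) auto
qed

text \<open>For \<open>d > 0\<close> this is the region above \<beta> = a^2 / (4 d); for
  \<open>d = 0\<close> it collapses to the ray a = 0, \<beta> \<ge> 0. Up to sign its support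
  function is the perspective d q^2 / p.\<close>

definition parabola :: "real \<Rightarrow> (real \<times> real) set" where
  "parabola d = {z. 0 \<le> fst z \<and> (snd z)\<^sup>2 \<le> 4 * d * fst z}"

lemma convex_parabola:
  assumes "0 \<le> d" shows "convex (parabola d)"
proof (rule convexI)
  fix x y :: "real \<times> real" and u v :: real
  assume x: "x \<in> parabola d" and y: "y \<in> parabola d" and uv: "0 \<le> u" "0 \<le> v" "u + v = 1"
  have "(u *\<^sub>R snd x + v *\<^sub>R snd y)\<^sup>2 \<le> u * (snd x)\<^sup>2 + v * (snd y)\<^sup>2"
    using convex_power2 uv unfolding convex_on_def by blast
  also have "\<dots> \<le> u * (4 * d * fst x) + v * (4 * d * fst y)"
    by (intro add_mono mult_left_mono) (use x y uv in \<open>auto simp: parabola_def\<close>)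
  finally show "u *\<^sub>R x + v *\<^sub>R y \<in> parabola d"
    using x y uv by (simp add: parabola_def algebra_simps)
qed

text \<open>A bound on the first slope bounds the second through the square root, so truncating one
  coordinate is enough.\<close>

lemma compact_parabola_part:
  assumes "0 \<le> d" shows "compact (parabola d \<inter> {z. fst z \<le> M})"
proof -
  have eq: "parabola d \<inter> {z. fst z \<le> M} =
    {z. 0 \<le> fst z} \<inter> {z. (snd z)\<^sup>2 \<le> 4 * d * fst z} \<inter> {z. fst z \<le> M}"
    by (auto simp: parabola_def)
  have "closed (parabola d \<inter> {z. fst z \<le> M})"
    unfolding eq by (intro closed_Int closed_Collect_le continuous_intros)
  moreover have "parabola d \<inter> {z. fst z \<le> M} \<subseteq> {0..M} \<times> cball 0 (sqrt (4 * d * M))"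
  proof (clarsimp simp: parabola_def)
    fix \<beta> a :: real assume "a\<^sup>2 \<le> 4 * d * \<beta>" "\<beta> \<le> M"
    then have "a\<^sup>2 \<le> 4 * d * M" using assms mult_left_mono[of \<beta> M "4*d"] by simp
    then have "\<bar>a\<bar> \<le> sqrt (4 * d * M)"
      using real_le_rsqrt by fastforce
    then show "\<bar>a\<bar> \<le> sqrt (4 * d * M)" .
  qed
  then have "bounded (parabola d \<inter> {z. fst z \<le> M})"
    by (rule bounded_subset[rotated]) (auto intro: bounded_Times)
  ultimately show ?thesis by (simp add: compact_eq_bounded_closed)
qed

text \<open>A direction in which all perspective denominators are positive makes the slopes coercive;
  this is what closes the difference of the two cones.\<close>

lemma persp_cone_slater:
  fixes P Q :: "'i \<Rightarrow> 'a::euclidean_space" and c v0 :: 'a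
  assumes fin: "finite N" "finite W"
    and d: "\<And>i. i \<in> N \<Longrightarrow> 0 \<le> d i"
    and v0: "\<And>a. a \<in> W \<Longrightarrow> a \<bullet> v0 \<le> 0" "\<And>i. i \<in> N \<Longrightarrow> 0 < P i \<bullet> v0"
    and nn: "\<And>v. (\<And>a. a \<in> W \<Longrightarrow> a \<bullet> v \<le> 0) \<Longrightarrow> (\<And>i. i \<in> N \<Longrightarrow> 0 < P i \<bullet> v)
      \<Longrightarrow> 0 \<le> c \<bullet> v + (\<Sum>i\<in>N. d i * (Q i \<bullet> v)\<^sup>2 / (P i \<bullet> v))"
  shows "\<exists>w\<in>convex_cone hull W. c + w \<in> persp_slopes N P Q (\<lambda>i. parabola (d i))"
proof (rule ccontr)
  define E where "E = persp_slopes N P Q (\<lambda>i. parabola (d i))"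
  \<comment> \<open>The claim says that \<open>c\<close> is a slope sum minus a cone element, hence
    lies in this Minkowski sum. If it does not, a hyperplane separates them once \<open>G\<close> is
    known to be closed and convex.\<close>
  define G where "G = (\<Union>e\<in>E. \<Union>w\<in>convex_cone hull (uminus ` W). {e + w})"
  assume neg: "\<not> ?thesis"
  have neghull: "convex_cone hull (uminus ` W) = uminus ` (convex_cone hull W)"
    by (rule convex_cone_hull_linear_image) (simp add: module_hom_uminus)
  have cG: "c \<notin> G"
    using neg by (auto simp: G_def E_def neghull)
  have cone_le: "w \<bullet> v \<ge> 0" if "w \<in> convex_cone hull (uminus ` W)"
      "\<And>a. a \<in> W \<Longrightarrow> a \<bullet> v \<le> 0" for v w
  proof -
    have "convex_cone hull (uminus ` W) \<subseteq> {w. v \<bullet> w \<ge> 0}"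
    proof (rule hull_minimal)
      show "uminus ` W \<subseteq> {w. v \<bullet> w \<ge> 0}" using that by (auto simp: inner_commute)
    qed (rule convex_cone_halfspace_ge)
    then show ?thesis using that by (auto simp: inner_commute)
  qed
  have slope_inner: "(\<Sum>i\<in>N. fst (s i) *\<^sub>R P i + snd (s i) *\<^sub>R Q i) \<bullet> v
     = (\<Sum>i\<in>N. fst (s i) * (P i \<bullet> v) + snd (s i) * (Q i \<bullet> v))" for s v
    by (simp add: inner_sum_left inner_add_left)
  have convG: "convex G"
    unfolding G_def E_def
    by (intro convex_sums convex_persp_slopes convex_parabola convex_convex_cone_hull fin d)
  have closedG: "closed G"
  proof -
    \<comment> \<open>Closedness is local: near \<open>g\<close> only points with x \<bullet> v0 < r
      matter, and those points of \<open>G\<close> lie in a compact set plus a closed cone.\<close>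
    have "g \<in> G" if g: "g \<in> closure G" for g
    proof -
      define r where "r = g \<bullet> v0 + 1"
      \<comment> \<open>One half of \<open>P i \<bullet> v0\<close> pays for the term with
        \<open>Q i\<close> through \<open>perspective_lower_bound\<close>; the other half is kept to
        bound \<open>fst (s i)\<close> by \<open>M i\<close>.\<close>
      define \<kappa> where "\<kappa> = (\<Sum>i\<in>N. d i * (Q i \<bullet> v0)\<^sup>2 / ((P i \<bullet> v0) / 2))"
      define M where "M i = (r + \<kappa>) / ((P i \<bullet> v0) / 2)" for i
      define E' where "E' = persp_slopes N P Q (\<lambda>i. parabola (d i) \<inter> {z. fst z \<le> M i})"
      define G' where "G' = (\<Union>e\<in>E'. \<Union>w\<in>convex_cone hull (uminus ` W). {e + w})"
      have "compact E'"
        unfolding E'_def by (intro compact_persp_slopes compact_parabola_part fin d)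
      then have clG': "closed G'"
        unfolding G'_def using fin by (intro compact_closed_sums closed_convex_cone_hull) auto
      have sub: "{x. x \<bullet> v0 < r} \<inter> G \<subseteq> G'"
      proof (clarsimp simp: G_def)
        fix e w assume e: "e \<in> E" and w: "w \<in> convex_cone hull (uminus ` W)"
          and lt: "(e + w) \<bullet> v0 < r"
        obtain s where s: "\<forall>i\<in>N. s i \<in> parabola (d i)"
          and es: "e = (\<Sum>i\<in>N. fst (s i) *\<^sub>R P i + snd (s i) *\<^sub>R Q i)"
          using e by (auto simp: E_def persp_slopes_def)
        have le: "e \<bullet> v0 \<le> r" using cone_le[OF w v0(1)] lt by (simp add: inner_add_left)
        have pos: "0 \<le> fst (s i) * ((P i \<bullet> v0) / 2)" if "i \<in> N" for i
          using s v0(2)[OF that] that by (auto simp: parabola_def)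
        have low: "fst (s i) * ((P i \<bullet> v0) / 2) - d i * (Q i \<bullet> v0)\<^sup>2 / ((P i \<bullet> v0) / 2)
            \<le> fst (s i) * (P i \<bullet> v0) + snd (s i) * (Q i \<bullet> v0)" if i: "i \<in> N" for i
          using perspective_lower_bound[of "fst (s i)" "snd (s i)" "d i" "(P i \<bullet> v0) / 2" "Q i \<bullet> v0"]
            s i d[OF i] v0(2)[OF i] pos[OF i] by (simp add: parabola_def)
        have tot: "(\<Sum>i\<in>N. fst (s i) * ((P i \<bullet> v0) / 2)) - \<kappa> \<le> e \<bullet> v0"
          unfolding es slope_inner \<kappa>_def sum_subtractf[symmetric] by (rule sum_mono) (use low in auto)
        have "fst (s i) \<le> M i" if i: "i \<in> N" for i
        proof -
          have "fst (s i) * ((P i \<bullet> v0) / 2) \<le> (\<Sum>i\<in>N. fst (s i) * ((P i \<bullet> v0) / 2))"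
            by (rule member_le_sum) (use i pos fin in auto)
          then have "fst (s i) * ((P i \<bullet> v0) / 2) \<le> r + \<kappa>" using tot le by simp
          then show ?thesis using v0(2)[OF i] by (simp add: M_def field_simps)
        qed
        then have "e \<in> E'" unfolding E'_def persp_slopes_def using s es by blast
        then show "e + w \<in> G'" using w by (auto simp: G'_def)
      qed
      have "open {x. x \<bullet> v0 < r}" by (intro open_Collect_less continuous_intros)
      then have "{x. x \<bullet> v0 < r} \<inter> closure G \<subseteq> closure ({x. x \<bullet> v0 < r} \<inter> G)"
        by (rule open_Int_closure_subset)
      also have "\<dots> \<subseteq> G'" using sub clG' by (rule closure_minimal)
      finally have "g \<in> G'" using g by (auto simp: r_def)
      moreover have "G' \<subseteq> G" by (force simp: G'_def G_def E'_def E_def persp_slopes_def)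
      ultimately show ?thesis by blast
    qed
    then show ?thesis by (metis closure_subset subsetI subset_antisym closed_closure)
  qed
  obtain v b where vc: "v \<bullet> c < b" and vG: "\<And>x. x \<in> G \<Longrightarrow> b < v \<bullet> x"
    using separating_hyperplane_closed_point[OF convG closedG cG] by blast
  have sG: "b < (\<Sum>i\<in>N. fst (s i) * (P i \<bullet> v) + snd (s i) * (Q i \<bullet> v)) + w \<bullet> v"
    if "\<forall>i\<in>N. s i \<in> parabola (d i)" "w \<in> convex_cone hull (uminus ` W)" for s w
  proof -
    have "(\<Sum>i\<in>N. fst (s i) *\<^sub>R P i + snd (s i) *\<^sub>R Q i) + w \<in> G"
      unfolding G_def E_def persp_slopes_def using that by blast
    then show ?thesis using vG[of "(\<Sum>i\<in>N. fst (s i) *\<^sub>R P i + snd (s i) *\<^sub>R Q i) + w"]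
      by (simp only: inner_add_right slope_inner[symmetric] inner_commute[of v])
  qed
  have zero_par: "(\<beta>, 0) \<in> parabola (d i)" if "0 \<le> \<beta>" "i \<in> N" for \<beta> i
    using that d by (simp add: parabola_def)
  have zero_hull: "0 \<in> convex_cone hull (uminus ` W)" by (rule convex_cone_hull_contains_0)
  have b0: "b < 0" using sG[of "\<lambda>_. (0,0)" 0] zero_par zero_hull by simp
  \<comment> \<open>Since \<open>b < 0\<close>, a linear function that stays above \<open>b\<close>
    along a ray from the origin cannot decrease. Rays in the cone and in the first slope coordinate
    thus give the signs of \<open>a \<bullet> v\<close> and \<open>P i \<bullet> v\<close>.\<close>
  have unbdd: "0 \<le> z" if "\<And>k. 0 \<le> k \<Longrightarrow> b < k * z" for z
  proof (rule ccontr)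
    assume "\<not> 0 \<le> z"
    then show False using that[of "b / z"] b0 by (simp add: divide_nonpos_neg)
  qed
  have vW: "a \<bullet> v \<le> 0" if "a \<in> W" for a
  proof -
    have "0 \<le> - (a \<bullet> v)"
    proof (rule unbdd)
      fix k :: real assume "0 \<le> k"
      then have "k *\<^sub>R (- a) \<in> convex_cone hull (uminus ` W)"
        using that by (intro convex_cone_hull_mul hull_inc) auto
      then show "b < k * - (a \<bullet> v)" using sG[of "\<lambda>_. (0,0)" "k *\<^sub>R (- a)"] zero_par by simp
    qed
    then show ?thesis by simp
  qed
  have vP: "0 \<le> P i \<bullet> v" if i: "i \<in> N" for i
  proof (rule unbdd)
    fix k :: real assume k: "0 \<le> k"
    define s where "s j = (if j = i then k else 0, 0::real)" for j
    have "b < (\<Sum>j\<in>N. fst (s j) * (P j \<bullet> v) + snd (s j) * (Q j \<bullet> v)) + 0 \<bullet> v"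
      by (rule sG) (use zero_par k zero_hull in \<open>auto simp: s_def\<close>)
    also have "\<dots> = k * (P i \<bullet> v)"
      using i fin by (simp add: s_def if_distrib[of "\<lambda>t. t * _"] cong: if_cong)
    finally show "b < k * (P i \<bullet> v)" .
  qed
  define \<kappa> where "\<kappa> = (\<Sum>i\<in>N. d i * (Q i \<bullet> v0)\<^sup>2 / (P i \<bullet> v0))"
  have main: "b < c \<bullet> v + \<epsilon> * (c \<bullet> v0 + \<kappa>)" if e: "0 < \<epsilon>" for \<epsilon>
  proof -
    \<comment> \<open>Denominators may vanish at the separating \<open>v\<close>; a small multiple
      of \<open>v0\<close> makes them positive, so that \<open>nn\<close> applies.\<close>
    define u where "u = v + \<epsilon> *\<^sub>R v0"
    have uP: "0 < P i \<bullet> u" if "i \<in> N" for i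
      using vP[OF that] v0(2)[OF that] e by (simp add: u_def inner_add_right add_nonneg_pos)
    have uW: "a \<bullet> u \<le> 0" if "a \<in> W" for a
      using vW[OF that] v0(1)[OF that] e
      by (simp add: u_def inner_add_right add_nonpos_nonpos mult_nonneg_nonpos)
    \<comment> \<open>The maximising slopes at \<open>u\<close>: for the ratio \<rho> = q / p they
      are (d \<rho>^2, -2 d \<rho>), on the boundary of the parabola.\<close>
    define s where "s i = (d i * ((Q i \<bullet> u) / (P i \<bullet> u))\<^sup>2, - 2 * d i * ((Q i \<bullet> u) / (P i \<bullet> u)))" for i
    have sp: "\<forall>i\<in>N. s i \<in> parabola (d i)"
      using d by (auto simp: s_def parabola_def power2_eq_square mult.assoc mult.left_commute)
    have "- (\<Sum>i\<in>N. d i * (Q i \<bullet> u)\<^sup>2 / (P i \<bullet> u))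
        = (\<Sum>i\<in>N. fst (s i) * (P i \<bullet> u) + snd (s i) * (Q i \<bullet> u))"
      unfolding sum_negf[symmetric]
    proof (rule sum.cong)
      fix i assume "i \<in> N"
      then show "- (d i * (Q i \<bullet> u)\<^sup>2 / (P i \<bullet> u)) = fst (s i) * (P i \<bullet> u) + snd (s i) * (Q i \<bullet> u)"
        using uP[of i] by (simp add: s_def field_simps power2_eq_square)
    qed simp
    also have "\<dots> = (\<Sum>i\<in>N. fst (s i) * (P i \<bullet> v) + snd (s i) * (Q i \<bullet> v))
        + \<epsilon> * (\<Sum>i\<in>N. fst (s i) * (P i \<bullet> v0) + snd (s i) * (Q i \<bullet> v0))"
      by (simp add: u_def inner_add_right sum.distrib sum_distrib_left algebra_simps)
    finally have eq: "- (\<Sum>i\<in>N. d i * (Q i \<bullet> u)\<^sup>2 / (P i \<bullet> u)) = \<dots>" .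
    have "- \<kappa> \<le> (\<Sum>i\<in>N. fst (s i) * (P i \<bullet> v0) + snd (s i) * (Q i \<bullet> v0))"
      unfolding \<kappa>_def sum_negf[symmetric]
    proof (rule sum_mono)
      fix i assume "i \<in> N"
      then show "- (d i * (Q i \<bullet> v0)\<^sup>2 / (P i \<bullet> v0)) \<le> fst (s i) * (P i \<bullet> v0) + snd (s i) * (Q i \<bullet> v0)"
        using perspective_lower_bound[of "fst (s i)" "snd (s i)" "d i" "P i \<bullet> v0" "Q i \<bullet> v0"]
          sp d v0(2) by (auto simp: parabola_def)
    qed
    then have "\<epsilon> * - \<kappa> \<le> \<epsilon> * (\<Sum>i\<in>N. fst (s i) * (P i \<bullet> v0) + snd (s i) * (Q i \<bullet> v0))"
      using e by (intro mult_left_mono) auto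
    moreover have "b < (\<Sum>i\<in>N. fst (s i) * (P i \<bullet> v) + snd (s i) * (Q i \<bullet> v))"
      using sG[OF sp zero_hull] by simp
    moreover have "0 \<le> c \<bullet> u + (\<Sum>i\<in>N. d i * (Q i \<bullet> u)\<^sup>2 / (P i \<bullet> u))"
      by (rule nn) (use uW uP in auto)
    ultimately have "b < c \<bullet> u + \<epsilon> * \<kappa>" using eq by (simp add: algebra_simps)
    then show ?thesis by (simp add: u_def inner_add_right algebra_simps)
  qed
  have "c \<bullet> v < b" using vc by (simp add: inner_commute)
  then have g: "0 < b - c \<bullet> v" by simp
  \<comment> \<open>This \<epsilon> makes the perturbation at most the gap
    \<open>b - c \<bullet> v\<close>, whatever the sign of \<open>c \<bullet> v0 + \<kappa>\<close>,
    and \<open>main\<close> then reads \<open>b < b\<close>.\<close>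
  have "b < c \<bullet> v + (b - c \<bullet> v) / (\<bar>c \<bullet> v0 + \<kappa>\<bar> + 1) * (c \<bullet> v0 + \<kappa>)"
    by (rule main) (use g in \<open>simp add: add_nonneg_pos\<close>)
  also have "(b - c \<bullet> v) / (\<bar>c \<bullet> v0 + \<kappa>\<bar> + 1) * (c \<bullet> v0 + \<kappa>) \<le> b - c \<bullet> v"
  proof -
    have "(b - c \<bullet> v) * (c \<bullet> v0 + \<kappa>) \<le> (b - c \<bullet> v) * (\<bar>c \<bullet> v0 + \<kappa>\<bar> + 1)"
      using g by (intro mult_left_mono) auto
    then show ?thesis by (simp add: divide_le_eq add_nonneg_pos)
  qed
  finally show False by simp
qed

section \<open>Farkas' lemma and facial reduction\<close>

lemma farkas_cone:
  fixes c :: "'a::euclidean_space"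
  assumes "finite W" "\<And>v. (\<And>a. a \<in> W \<Longrightarrow> a \<bullet> v \<le> 0) \<Longrightarrow> 0 \<le> c \<bullet> v"
  shows "- c \<in> convex_cone hull W"
proof -
  \<comment> \<open>Without perspective terms there are no denominators, so \<open>v0 = 0\<close>
    qualifies and the only slope sum is 0.\<close>
  have "\<exists>w\<in>convex_cone hull W. c + w \<in> persp_slopes {} (\<lambda>_::unit. 0) (\<lambda>_. 0) (\<lambda>i. parabola 0)"
    by (rule persp_cone_slater[where ?v0.0 = 0]) (use assms in auto)
  then show ?thesis by (auto simp: persp_slopes_def add_eq_0_iff)
qed

text \<open>Facial reduction: an index whose denominator vanishes on the whole cone is moved into the
  linear constraints; the multipliers of these are then absorbed by a large multiple of a
  certificate for \<open>P i \<bullet> v \<le> 0\<close>, which is possible since \<open>d i > 0\<close>.\<close>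

lemma persp_cone:
  fixes P Q :: "'i \<Rightarrow> 'a::euclidean_space" and c :: 'a
  assumes "finite N" "finite W"
    and "\<And>i. i \<in> N \<Longrightarrow> 0 \<le> d i"
    and "\<And>v. (\<And>a. a \<in> W \<Longrightarrow> a \<bullet> v \<le> 0) \<Longrightarrow>
        (\<And>i. i \<in> N \<Longrightarrow> 0 < P i \<bullet> v \<or> P i \<bullet> v = 0 \<and> Q i \<bullet> v = 0)
      \<Longrightarrow> 0 \<le> c \<bullet> v + (\<Sum>i\<in>N. d i * (Q i \<bullet> v)\<^sup>2 / (P i \<bullet> v))"
    and "\<And>i. i \<in> N \<Longrightarrow> d i = 0 \<Longrightarrow> \<exists>v. (\<forall>a\<in>W. a \<bullet> v \<le> 0) \<and>
        (\<forall>j\<in>N. 0 < P j \<bullet> v \<or> P j \<bullet> v = 0 \<and> Q j \<bullet> v = 0) \<and> 0 < P i \<bullet> v"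
  shows "\<exists>w\<in>convex_cone hull W. c + w \<in> persp_slopes N P Q (\<lambda>i. parabola (d i))"
  using assms
proof (induction "card N" arbitrary: N W)
  case 0
  then show ?case by (intro persp_cone_slater[where ?v0.0 = 0]) auto
next
  case (Suc n)
  note fN = Suc.prems(1) and fW = Suc.prems(2) and d = Suc.prems(3)
    and nn = Suc.prems(4) and qual = Suc.prems(5)
  define K where "K = {v. (\<forall>a\<in>W. a \<bullet> v \<le> 0) \<and> (\<forall>j\<in>N. 0 \<le> P j \<bullet> v)}"
  show ?case
  proof (cases "\<forall>i\<in>N. \<exists>v\<in>K. 0 < P i \<bullet> v")
    case True
    then obtain V where V: "\<And>i. i \<in> N \<Longrightarrow> V i \<in> K" "\<And>i. i \<in> N \<Longrightarrow> 0 < P i \<bullet> V i" by metis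
    \<comment> \<open>All \<open>P j\<close> are nonnegative on the convex cone \<open>K\<close>, so
      the sum of one witness per index makes every denominator positive at once.\<close>
    define v0 where "v0 = (\<Sum>i\<in>N. V i)"
    have "a \<bullet> v0 \<le> 0" if "a \<in> W" for a
      unfolding v0_def inner_sum_right by (rule sum_nonpos) (use V that in \<open>auto simp: K_def\<close>)
    moreover have "0 < P i \<bullet> v0" if "i \<in> N" for i
      unfolding v0_def inner_sum_right
      by (rule sum_pos2[OF fN that]) (use V that in \<open>auto simp: K_def\<close>)
    ultimately show ?thesis
      by (intro persp_cone_slater[where ?v0.0 = v0]) (use fN fW d nn in auto)
  next
    case False
    then obtain i where i: "i \<in> N" and Pi: "\<And>v. v \<in> K \<Longrightarrow> P i \<bullet> v = 0"
      by (fastforce simp: K_def)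
    have di: "0 < d i"
    proof (rule ccontr)
      assume "\<not> 0 < d i"
      then have "d i = 0" using d[OF i] by simp
      from qual[OF i this] obtain v where "v \<in> K" "0 < P i \<bullet> v"
        by (auto simp: K_def) (metis less_eq_real_def)
      then show False using Pi by fastforce
    qed
    define N' where "N' = N - {i}"
    \<comment> \<open>Both signs are included to turn \<open>P i \<bullet> v = 0\<close> and
      \<open>Q i \<bullet> v = 0\<close> into inequalities.\<close>
    define F where "F = {P i, - P i, Q i, - Q i}"
    have cN': "card N' = n" "finite N'" "i \<notin> N'" and N: "N = insert i N'"
      using Suc.hyps(2) i fN by (auto simp: N'_def)
    have F0: "P i \<bullet> v = 0 \<and> Q i \<bullet> v = 0" if "\<And>a. a \<in> W \<union> F \<Longrightarrow> a \<bullet> v \<le> 0" for v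
      using that[of "P i"] that[of "- P i"] that[of "Q i"] that[of "- Q i"]
      by (auto simp: F_def)
    have "\<exists>w\<in>convex_cone hull (W \<union> F). c + w \<in> persp_slopes N' P Q (\<lambda>i. parabola (d i))"
    proof (rule Suc.hyps(1))
      fix v assume W': "\<And>a. a \<in> W \<union> F \<Longrightarrow> a \<bullet> v \<le> 0"
        and N'': "\<And>i. i \<in> N' \<Longrightarrow> 0 < P i \<bullet> v \<or> P i \<bullet> v = 0 \<and> Q i \<bullet> v = 0"
      have "0 \<le> c \<bullet> v + (\<Sum>i\<in>N. d i * (Q i \<bullet> v)\<^sup>2 / (P i \<bullet> v))"
        by (rule nn) (use W' N'' F0[OF W'] in \<open>auto simp: N\<close>)
      then show "0 \<le> c \<bullet> v + (\<Sum>i\<in>N'. d i * (Q i \<bullet> v)\<^sup>2 / (P i \<bullet> v))"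
        using F0[OF W'] cN' by (simp add: N)
    next
      fix k assume k: "k \<in> N'" "d k = 0"
      then obtain v where v: "\<forall>a\<in>W. a \<bullet> v \<le> 0"
          "\<forall>j\<in>N. 0 < P j \<bullet> v \<or> P j \<bullet> v = 0 \<and> Q j \<bullet> v = 0" "0 < P k \<bullet> v"
        using qual[of k] by (auto simp: N)
      have "v \<in> K" unfolding K_def using v by fastforce
      then have "P i \<bullet> v = 0" by (rule Pi)
      then have "P i \<bullet> v = 0 \<and> Q i \<bullet> v = 0" using v(2) i by fastforce
      then show "\<exists>v. (\<forall>a\<in>W \<union> F. a \<bullet> v \<le> 0) \<and>
          (\<forall>j\<in>N'. 0 < P j \<bullet> v \<or> P j \<bullet> v = 0 \<and> Q j \<bullet> v = 0) \<and> 0 < P k \<bullet> v"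
        using v by (intro exI[of _ v]) (auto simp: F_def N)
    qed (use cN' fW d in \<open>auto simp: F_def N\<close>)
    then obtain w f where w: "w \<in> convex_cone hull W" and f: "f \<in> convex_cone hull F"
      and cwf: "c + (w + f) \<in> persp_slopes N' P Q (\<lambda>i. parabola (d i))"
      unfolding convex_cone_hull_Un by auto
    have "convex_cone hull F \<subseteq> span {P i, Q i}"
      by (rule hull_minimal) (auto simp: F_def convex_cone_span intro: span_base span_neg)
    with f obtain p q where pq: "f = p *\<^sub>R P i + q *\<^sub>R Q i"
      by (auto simp: span_insert span_singleton algebra_simps)
    from cwf obtain s where s: "\<And>j. j \<in> N' \<Longrightarrow> s j \<in> parabola (d j)"
      and cs: "c + (w + f) = (\<Sum>j\<in>N'. fst (s j) *\<^sub>R P j + snd (s j) *\<^sub>R Q j)"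
      by (auto simp: persp_slopes_def)
    \<comment> \<open>\<open>P i\<close> vanishes on \<open>K\<close>, so Farkas' lemma certifies
      \<open>P i \<bullet> v \<le> 0\<close>: it writes \<open>P i\<close> as \<open>w1\<close>
      minus a nonnegative combination of the \<open>P j\<close>.\<close>
    have "- (- P i) \<in> convex_cone hull (W \<union> (\<lambda>j. - P j) ` N)"
    proof (rule farkas_cone)
      fix v assume h: "\<And>a. a \<in> W \<union> (\<lambda>j. - P j) ` N \<Longrightarrow> a \<bullet> v \<le> 0"
      have "v \<in> K" unfolding K_def using h by (fastforce simp: image_iff)
      then show "0 \<le> - P i \<bullet> v" using Pi by simp
    qed (use fW fN in auto)
    then obtain w1 r where w1: "w1 \<in> convex_cone hull W"
      and r: "r \<in> convex_cone hull ((\<lambda>j. - P j) ` N)" and Pw: "P i = w1 + r"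
      unfolding convex_cone_hull_Un by auto
    obtain \<nu> where \<nu>: "\<And>j. 0 \<le> \<nu> j" "r = (\<Sum>j\<in>N. \<nu> j *\<^sub>R - P j)"
      using convex_cone_hull_image_sum[OF fN r] by blast
    \<comment> \<open>Adding \<open>M\<close> copies of the certificate leaves index
      \<open>i\<close> with the slopes \<open>M - p + M * \<nu> i\<close> and \<open>- q\<close>.
      The choice of \<open>M\<close> gives q^2 \<le> 4 d (M - p), which puts them into the parabola.
      The other indices only gain in the first slope, which stays inside theirs.\<close>
    define M where "M = max 0 (max p (p + q\<^sup>2 / (4 * d i)))"
    have M: "0 \<le> M" "p \<le> M" "q\<^sup>2 \<le> 4 * d i * (M - p)"
    proof -
      have "p + q\<^sup>2 / (4 * d i) \<le> M" by (simp add: M_def)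
      then have "q\<^sup>2 / (4 * d i) \<le> M - p" by simp
      then show "q\<^sup>2 \<le> 4 * d i * (M - p)" using di by (simp add: divide_le_eq mult.commute)
    qed (auto simp: M_def)
    define s' where "s' j = (if j = i then (M - p + M * \<nu> i, - q)
      else (fst (s j) + M * \<nu> j, snd (s j)))" for j
    have "s' j \<in> parabola (d j)" if "j \<in> N" for j
    proof (cases "j = i")
      case True
      have "0 \<le> M * \<nu> i" using M \<nu> by simp
      moreover from this have "0 \<le> 4 * d i * (M * \<nu> i)" using di by simp
      ultimately show ?thesis using M True by (simp add: s'_def parabola_def algebra_simps)
    next
      case False
      then have sj: "s j \<in> parabola (d j)" using that N s by auto
      have "0 \<le> M * \<nu> j" using M \<nu> by simp
      moreover from this have "0 \<le> 4 * d j * (M * \<nu> j)" using d[OF that] by simp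
      ultimately show ?thesis using False sj by (simp add: s'_def parabola_def algebra_simps)
    qed
    moreover have "c + (w + M *\<^sub>R w1) = (\<Sum>j\<in>N. fst (s' j) *\<^sub>R P j + snd (s' j) *\<^sub>R Q j)"
    proof -
      have c: "c = (\<Sum>j\<in>N'. fst (s j) *\<^sub>R P j + snd (s j) *\<^sub>R Q j) - w - p *\<^sub>R P i - q *\<^sub>R Q i"
        using cs pq by (simp add: algebra_simps)
      have w1': "w1 = P i + \<nu> i *\<^sub>R P i + (\<Sum>j\<in>N'. \<nu> j *\<^sub>R P j)"
        using Pw \<nu>(2) cN' by (simp add: N sum_negf algebra_simps)
      have "(\<Sum>j\<in>N'. fst (s' j) *\<^sub>R P j + snd (s' j) *\<^sub>R Q j)
          = (\<Sum>j\<in>N'. fst (s j) *\<^sub>R P j + snd (s j) *\<^sub>R Q j + M *\<^sub>R (\<nu> j *\<^sub>R P j))"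
        by (rule sum.cong) (use cN' in \<open>auto simp: s'_def algebra_simps\<close>)
      also have "\<dots> = (\<Sum>j\<in>N'. fst (s j) *\<^sub>R P j + snd (s j) *\<^sub>R Q j) + M *\<^sub>R (\<Sum>j\<in>N'. \<nu> j *\<^sub>R P j)"
        by (simp only: sum.distrib scaleR_sum_right)
      finally have "(\<Sum>j\<in>N. fst (s' j) *\<^sub>R P j + snd (s' j) *\<^sub>R Q j)
        = (M - p + M * \<nu> i) *\<^sub>R P i - q *\<^sub>R Q i + \<dots>"
        using cN' by (simp add: N s'_def)
      then show ?thesis unfolding c w1' by (simp add: algebra_simps)
    qed
    ultimately have "c + (w + M *\<^sub>R w1) \<in> persp_slopes N P Q (\<lambda>i. parabola (d i))"
      unfolding persp_slopes_def by blast
    moreover have "w + M *\<^sub>R w1 \<in> convex_cone hull W"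
      using w w1 M by (intro convex_cone_hull_add convex_cone_hull_mul)
    ultimately show ?thesis by blast
  qed
qed

section \<open>The perspective program\<close>

lemma inner_matrix_vector_columns:
  fixes M :: "real^'n^'m"
  shows "u \<bullet> (M *v v) = (\<Sum>i\<in>UNIV. (u \<bullet> column i M) * v $ i)"
proof -
  have "u \<bullet> (M *v v) = (\<Sum>k\<in>UNIV. \<Sum>i\<in>UNIV. u $ k * M $ k $ i * v $ i)"
    by (simp add: inner_vec_def matrix_vector_mult_def sum_distrib_left mult.assoc)
  also have "\<dots> = (\<Sum>i\<in>UNIV. \<Sum>k\<in>UNIV. u $ k * M $ k $ i * v $ i)"
    by (rule sum.swap)
  also have "\<dots> = (\<Sum>i\<in>UNIV. (u \<bullet> column i M) * v $ i)"
    by (simp add: inner_vec_def column_def sum_distrib_right)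
  finally show ?thesis .
qed

lemma inner_vec_nonpos:
  fixes l v :: "real^'m"
  assumes "0 \<le> l" "v \<le> 0"
  shows "l \<bullet> v \<le> 0"
  unfolding inner_vec_def
  by (rule sum_nonpos) (use assms in \<open>auto simp: less_eq_vec_def mult_nonneg_nonpos\<close>)

text \<open>Zero extension identifies the reduced space with a coordinate subspace, on which the
  reduced program becomes the full one with \<open>x\<close> fixed.\<close>

definition restr :: "'n set \<Rightarrow> real^'n \<Rightarrow> real^'n" where
  "restr S v = (\<chi> i. if i \<in> S then v $ i else 0)"

lemma restr_nth [simp]: "restr S v $ i = (if i \<in> S then v $ i else 0)"
  by (simp add: restr_def)

lemma restr_idem: "(\<And>i. i \<notin> S \<Longrightarrow> v $ i = 0) \<Longrightarrow> restr S v = v"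
  by (simp add: vec_eq_iff)

lemma sub_mv_restr: "sub_mv S M v = M *v restr S v"
  by (simp add: sub_mv_def matrix_vector_mult_def vec_eq_iff if_distrib[of "\<lambda>t. _ * t"]
      sum.If_cases cong: if_cong)

lemma inner_restr: "u \<bullet> restr S v = restr S u \<bullet> v"
  by (auto simp: inner_vec_def intro!: sum.cong)

text \<open>Read \<open>a\<close> as the slack of a constraint and \<open>c\<close> as its rate of
  change: positive slack survives any small step, zero slack needs a nonnegative rate.\<close>

lemma eventually_pos_step:
  fixes a c :: real
  assumes "0 < a \<or> a = 0 \<and> 0 \<le> c"
  shows "\<forall>\<^sub>F \<epsilon> in at_right 0. 0 \<le> a + \<epsilon> * c"
proof (cases "0 < a")
  case True
  have "((\<lambda>\<epsilon>. a + \<epsilon> * c) \<longlongrightarrow> a + 0 * c) (at_right 0)" by (intro tendsto_intros)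
  then have "\<forall>\<^sub>F \<epsilon> in at_right 0. 0 < a + \<epsilon> * c"
    by (rule order_tendstoD) (use True in simp)
  then show ?thesis by (rule eventually_mono) simp
next
  case False
  with assms show ?thesis
    using eventually_at_right_less[of "0::real"] by (auto elim!: eventually_mono)
qed

text \<open>Turns cone coefficients on active rows into a full multiplier vector; its zeros on the
  remaining rows later give complementary slackness.\<close>

lemma sum_row_nth:
  fixes M :: "real^'n^'m"
  shows "(\<Sum>k\<in>I. \<nu> k *\<^sub>R row k M) $ i = (\<chi> k. if k \<in> I then \<nu> k else 0) \<bullet> column i M"
  by (simp add: inner_vec_def column_def row_def if_distrib[of "\<lambda>t. t * _"] sum.If_cases cong: if_cong)

lemma row_inner: "row k M \<bullet> v = (M *v v) $ k"
  by (simp add: matrix_vector_mul_component row_def)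

lemma fst_axis_sum:
  fixes N :: "'n::finite set"
  shows "fst (\<Sum>i\<in>N. \<beta> i *\<^sub>R (axis i 1, 0) + \<alpha> i *\<^sub>R (0, axis i 1)) $ j
      = (if j \<in> N then \<beta> j else (0::real))"
    "snd (\<Sum>i\<in>N. \<beta> i *\<^sub>R (axis i 1, 0) + \<alpha> i *\<^sub>R (0, axis i 1)) $ j
      = (if j \<in> N then \<alpha> j else (0::real))"
  by (simp_all add: fst_sum snd_sum axis_def if_distrib[of "\<lambda>t. _ * t"] sum.If_cases cong: if_cong)

text \<open>The sums may run over all indices because the entries of \<open>restr\<close> vanish off
  the support.\<close>

lemma red_obj_restr:
  "red_obj R \<delta> g x v = restr (supp x) v \<bullet> (R *v restr (supp x) v)
    + (\<Sum>i\<in>UNIV. \<delta> $ i * (restr (supp x) v $ i)\<^sup>2 / x $ i) + g \<bullet> restr (supp x) v"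
proof -
  let ?S = "supp x"
  have row: "(\<Sum>j\<in>?S. v $ i * (R $ i $ j + (if i = j then \<delta> $ i / x $ i else 0)) * v $ j)
      = v $ i * (\<Sum>j\<in>?S. R $ i $ j * v $ j) + \<delta> $ i * (v $ i)\<^sup>2 / x $ i" if "i \<in> ?S" for i
  proof -
    have "(\<Sum>j\<in>?S. v $ i * (R $ i $ j + (if i = j then \<delta> $ i / x $ i else 0)) * v $ j)
      = (\<Sum>j\<in>?S. v $ i * (R $ i $ j * v $ j) + (if i = j then \<delta> $ i * (v $ i)\<^sup>2 / x $ i else 0))"
      by (rule sum.cong) (auto simp: algebra_simps power2_eq_square)
    then show ?thesis using that by (simp add: sum.distrib sum_distrib_left)
  qed
  have UN: "(\<Sum>i\<in>?S. f i) = (\<Sum>i\<in>UNIV. if i \<in> ?S then f i else 0)" for f :: "'a \<Rightarrow> real"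
    by (simp add: sum.If_cases)
  have "red_obj R \<delta> g x v = (\<Sum>i\<in>?S. v $ i * (\<Sum>j\<in>?S. R $ i $ j * v $ j))
     + (\<Sum>i\<in>?S. \<delta> $ i * (v $ i)\<^sup>2 / x $ i) + (\<Sum>i\<in>?S. g $ i * v $ i)"
    unfolding red_obj_def by (simp add: row sum.distrib)
  also have "(\<Sum>i\<in>?S. v $ i * (\<Sum>j\<in>?S. R $ i $ j * v $ j)) = restr ?S v \<bullet> (R *v restr ?S v)"
    unfolding inner_vec_def matrix_vector_mult_def UN by (auto intro!: sum.cong)
  also have "(\<Sum>i\<in>?S. \<delta> $ i * (v $ i)\<^sup>2 / x $ i) = (\<Sum>i\<in>UNIV. \<delta> $ i * (restr ?S v $ i)\<^sup>2 / x $ i)"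
    unfolding UN by (auto intro!: sum.cong)
  also have "(\<Sum>i\<in>?S. g $ i * v $ i) = g \<bullet> restr ?S v"
    unfolding inner_vec_def UN by (auto intro!: sum.cong)
  finally show ?thesis .
qed

text \<open>The constant is the minimum of the form on the compact unit sphere; homogeneity of
  degree two extends the bound.\<close>

lemma pos_definite_coercive:
  fixes Q :: "real^'n^'n"
  assumes "pos_definite Q"
  obtains c where "0 < c" "\<And>v. c * (norm v)\<^sup>2 \<le> v \<bullet> (Q *v v)"
proof -
  have "continuous_on (sphere (0 :: real^'n) 1) (\<lambda>v. v \<bullet> (Q *v v))"
    by (intro continuous_intros matrix_vector_mult_linear_continuous_on)
  moreover have "axis undefined 1 \<in> sphere (0 :: real^'n) 1" by simp
  then have "sphere (0 :: real^'n) 1 \<noteq> {}" by blast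
  ultimately have "\<exists>u\<in>sphere (0 :: real^'n) 1. \<forall>v\<in>sphere 0 1. u \<bullet> (Q *v u) \<le> v \<bullet> (Q *v v)"
    by (intro continuous_attains_inf compact_sphere)
  then obtain u where u: "u \<in> sphere (0 :: real^'n) 1"
    "\<And>v. v \<in> sphere 0 1 \<Longrightarrow> u \<bullet> (Q *v u) \<le> v \<bullet> (Q *v v)"
    by blast
  have "u \<noteq> 0" using u(1) by auto
  then have "0 < u \<bullet> (Q *v u)" using assms by (simp add: pos_definite_def)
  moreover have "(u \<bullet> (Q *v u)) * (norm v)\<^sup>2 \<le> v \<bullet> (Q *v v)" for v
  proof (cases "v = 0")
    case False
    have "u \<bullet> (Q *v u) \<le> sgn v \<bullet> (Q *v sgn v)" using False by (intro u(2)) (simp add: norm_sgn)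
    also have "\<dots> = inverse (norm v) * (inverse (norm v) * (v \<bullet> (Q *v v)))"
      by (simp only: sgn_div_norm matrix_vector_mult_scaleR inner_scaleR_left inner_scaleR_right)
    also have "\<dots> = v \<bullet> (Q *v v) / (norm v)\<^sup>2"
      by (simp add: power2_eq_square divide_inverse)
    finally show ?thesis using False by (simp add: pos_le_divide_eq)
  qed simp
  ultimately show thesis using that by blast
qed

section \<open>The perspective program as a real function on its domain\<close>

locale persp_qp =
  fixes R :: "real^'n^'n" and \<delta> g h :: "real^'n" and A :: "real^'n^'m1" and b :: "real^'m1"
    and C D :: "real^'n^'m2"
  assumes psd: "pos_semidefinite R" and \<delta>: "0 \<le> \<delta> $ i"
begin

definition in_dom :: "real^'n \<Rightarrow> real^'n \<Rightarrow> bool" where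
  "in_dom x y \<longleftrightarrow> (\<forall>i. 0 < x $ i \<or> x $ i = 0 \<and> y $ i = 0)"

definition feas :: "real^'n \<Rightarrow> real^'n \<Rightarrow> bool" where
  "feas x y \<longleftrightarrow> in_dom x y \<and> A *v y \<le> b \<and> C *v y \<le> D *v x"

text \<open>Division by zero yields 0, which is the closed perspective at the origin. The formula
  represents the objective only where \<open>in_dom\<close> holds.\<close>

definition val :: "real^'n \<Rightarrow> real^'n \<Rightarrow> real" where
  "val x y = y \<bullet> (R *v y) + (\<Sum>i\<in>UNIV. \<delta> $ i * (y $ i)\<^sup>2 / x $ i) + g \<bullet> y + h \<bullet> x"

lemma f_persp_eq:
  "f_persp R \<delta> g h A b C D x y = (if feas x y then ereal (val x y) else \<infinity>)"
proof -
  have summand: "dom_scale (\<delta> $ i) (persp (y $ i) (x $ i)) =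
      (if 0 < x $ i \<or> x $ i = 0 \<and> y $ i = 0 then ereal (\<delta> $ i * (y $ i)\<^sup>2 / x $ i) else \<infinity>)" for i
    by (auto simp: dom_scale_def persp_def)
  show ?thesis
  proof (cases "in_dom x y")
    case True
    then have "(\<Sum>i\<in>UNIV. dom_scale (\<delta> $ i) (persp (y $ i) (x $ i)))
        = ereal (\<Sum>i\<in>UNIV. \<delta> $ i * (y $ i)\<^sup>2 / x $ i)"
      unfolding summand by (simp add: in_dom_def)
    with True show ?thesis
      by (simp add: f_persp_def feas_def val_def indicator_fun_def F1_def F2_def)
  next
    case False
    then obtain i where "\<not> (0 < x $ i \<or> x $ i = 0 \<and> y $ i = 0)"
      unfolding in_dom_def by blast
    then have "dom_scale (\<delta> $ i) (persp (y $ i) (x $ i)) = \<infinity>"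
      unfolding summand by simp
    then have "(\<Sum>i\<in>UNIV. dom_scale (\<delta> $ i) (persp (y $ i) (x $ i))) = \<infinity>"
      unfolding sum_Pinfty by auto
    with False show ?thesis
      by (simp add: f_persp_def feas_def indicator_fun_def)
  qed
qed

lemma fbar_le: "feas x y \<Longrightarrow> fbar_persp R \<delta> g h A b C D x \<le> ereal (val x y)"
  unfolding fbar_persp_def by (rule INF_lower2[of y]) (auto simp: f_persp_eq)

lemma fbar_ge: "(\<And>y. feas x y \<Longrightarrow> r \<le> val x y) \<Longrightarrow> ereal r \<le> fbar_persp R \<delta> g h A b C D x"
  unfolding fbar_persp_def by (rule INF_greatest) (auto simp: f_persp_eq)

lemma fbar_less_top: "fbar_persp R \<delta> g h A b C D x < \<infinity> \<longleftrightarrow> (\<exists>y. feas x y)"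
  unfolding fbar_persp_def INF_less_iff by (auto simp: f_persp_eq)

lemma R_sym: "u \<bullet> (R *v v) = v \<bullet> (R *v u)"
  using psd by (metis dot_lmul_matrix inner_commute pos_semidefinite_def transpose_matrix_vector)

lemma column_R: "column i R \<bullet> y = (R *v y) $ i"
proof -
  have "column i R = R *v axis i 1" by (simp add: matrix_vector_mult_basis)
  then have "column i R \<bullet> y = axis i 1 \<bullet> (R *v y)" by (metis R_sym inner_commute)
  then show ?thesis by (simp add: inner_axis')
qed

text \<open>The gradient inequality of a convex quadratic: the gap is the form at
  \<open>w - y\<close>.\<close>

lemma quadratic_lower: "y \<bullet> (R *v y) + 2 * ((w - y) \<bullet> (R *v y)) \<le> w \<bullet> (R *v w)"
proof -
  have "0 \<le> (w - y) \<bullet> (R *v (w - y))" using psd by (simp add: pos_semidefinite_def)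
  then show ?thesis using R_sym[of w y]
    by (simp add: matrix_vector_mult_diff_distrib inner_diff_left inner_diff_right)
qed

section \<open>First-order conditions along feasible directions\<close>

lemma val_deriv:
  assumes y0: "\<And>i. x $ i = 0 \<Longrightarrow> y $ i = 0"
  shows "((\<lambda>\<epsilon>. val (x + \<epsilon> *\<^sub>R p) (y + \<epsilon> *\<^sub>R q)) has_real_derivative
     (2 * (q \<bullet> (R *v y)) + (\<Sum>i\<in>UNIV. if x $ i = 0 then \<delta> $ i * (q $ i)\<^sup>2 / p $ i
        else \<delta> $ i * (2 * (y $ i / x $ i) * q $ i - (y $ i)\<^sup>2 / (x $ i)\<^sup>2 * p $ i))
      + g \<bullet> q + h \<bullet> p)) (at 0)"
proof -
  have quad: "(y + \<epsilon> *\<^sub>R q) \<bullet> (R *v (y + \<epsilon> *\<^sub>R q))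
      = y \<bullet> (R *v y) + \<epsilon> * (2 * (q \<bullet> (R *v y))) + \<epsilon>\<^sup>2 * (q \<bullet> (R *v q))" for \<epsilon>
    using R_sym[of y q]
    by (simp add: matrix_vector_right_distrib matrix_vector_mult_scaleR inner_add_left inner_add_right
        power2_eq_square algebra_simps)
  have summand: "((\<lambda>\<epsilon>. \<delta> $ i * ((y + \<epsilon> *\<^sub>R q) $ i)\<^sup>2 / (x + \<epsilon> *\<^sub>R p) $ i) has_real_derivative
      (if x $ i = 0 then \<delta> $ i * (q $ i)\<^sup>2 / p $ i
        else \<delta> $ i * (2 * (y $ i / x $ i) * q $ i - (y $ i)\<^sup>2 / (x $ i)\<^sup>2 * p $ i))) (at 0)" for i
  proof (cases "x $ i = 0")
    case True
    \<comment> \<open>From the origin the term is exactly linear in \<epsilon>, also for negative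
      \<epsilon> and, by the value of division by zero, at 0. A two-sided derivative therefore
      exists although negative steps may leave the domain.\<close>
    have "(\<lambda>\<epsilon>. \<delta> $ i * ((y + \<epsilon> *\<^sub>R q) $ i)\<^sup>2 / (x + \<epsilon> *\<^sub>R p) $ i)
        = (\<lambda>\<epsilon>. \<epsilon> * (\<delta> $ i * (q $ i)\<^sup>2 / p $ i))"
      using y0[OF True] True by (auto simp: power2_eq_square fun_eq_iff)
    moreover have "((\<lambda>\<epsilon>. \<epsilon> * c) has_real_derivative c) (at 0)" for c :: real
      by (auto intro!: derivative_eq_intros)
    ultimately show ?thesis unfolding if_P[OF True] by (simp only:)
  next
    case False
    have "((\<lambda>\<epsilon>. \<delta> $ i * (y $ i + \<epsilon> * q $ i)\<^sup>2) has_real_derivative \<delta> $ i * (2 * y $ i * q $ i)) (at 0)"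
      "((\<lambda>\<epsilon>. x $ i + \<epsilon> * p $ i) has_real_derivative p $ i) (at 0)"
      by (auto intro!: derivative_eq_intros)
    from DERIV_divide[OF this] False
    have "((\<lambda>\<epsilon>. \<delta> $ i * (y $ i + \<epsilon> * q $ i)\<^sup>2 / (x $ i + \<epsilon> * p $ i)) has_real_derivative
      (\<delta> $ i * (2 * y $ i * q $ i) * x $ i - \<delta> $ i * (y $ i)\<^sup>2 * p $ i) / (x $ i * x $ i)) (at 0)"
      by simp
    moreover have "(\<delta> $ i * (2 * y $ i * q $ i) * x $ i - \<delta> $ i * (y $ i)\<^sup>2 * p $ i) / (x $ i * x $ i)
      = \<delta> $ i * (2 * (y $ i / x $ i) * q $ i - (y $ i)\<^sup>2 / (x $ i)\<^sup>2 * p $ i)"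
      using False by (simp add: field_simps power2_eq_square)
    ultimately have "((\<lambda>\<epsilon>. \<delta> $ i * (y $ i + \<epsilon> * q $ i)\<^sup>2 / (x $ i + \<epsilon> * p $ i)) has_real_derivative
      \<delta> $ i * (2 * (y $ i / x $ i) * q $ i - (y $ i)\<^sup>2 / (x $ i)\<^sup>2 * p $ i)) (at 0)"
      by simp
    with False show ?thesis by simp
  qed
  have "((\<lambda>\<epsilon>. (y \<bullet> (R *v y) + \<epsilon> * (2 * (q \<bullet> (R *v y))) + \<epsilon>\<^sup>2 * (q \<bullet> (R *v q)))
      + (\<Sum>i\<in>UNIV. \<delta> $ i * ((y + \<epsilon> *\<^sub>R q) $ i)\<^sup>2 / (x + \<epsilon> *\<^sub>R p) $ i)
      + (g \<bullet> y + \<epsilon> * (g \<bullet> q)) + (h \<bullet> x + \<epsilon> * (h \<bullet> p))) has_real_derivative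
     (2 * (q \<bullet> (R *v y)) + (\<Sum>i\<in>UNIV. if x $ i = 0 then \<delta> $ i * (q $ i)\<^sup>2 / p $ i
        else \<delta> $ i * (2 * (y $ i / x $ i) * q $ i - (y $ i)\<^sup>2 / (x $ i)\<^sup>2 * p $ i))
      + g \<bullet> q + h \<bullet> p)) (at 0)"
    by (intro DERIV_add DERIV_sum summand) (auto intro!: derivative_eq_intros)
  then show ?thesis
    unfolding val_def quad by (simp only: inner_add_right inner_scaleR_right)
qed

text \<open>Only active rows restrict a direction. Where \<open>x $ i = 0\<close> a step scales the
  pair of entries of \<open>p\<close> and \<open>q\<close>, so this pair itself must lie in the
  domain of the perspective.\<close>

definition feas_dir :: "real^'n \<Rightarrow> real^'n \<Rightarrow> real^'n \<Rightarrow> real^'n \<Rightarrow> bool" where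
  "feas_dir x y p q \<longleftrightarrow>
     (\<forall>k. (A *v y) $ k = b $ k \<longrightarrow> (A *v q) $ k \<le> 0)
     \<and> (\<forall>k. (C *v y) $ k = (D *v x) $ k \<longrightarrow> (C *v q) $ k \<le> (D *v p) $ k)
     \<and> (\<forall>i. x $ i = 0 \<longrightarrow> 0 < p $ i \<or> p $ i = 0 \<and> q $ i = 0)"

lemma eventually_feas:
  assumes "feas x y" "feas_dir x y p q"
  shows "\<forall>\<^sub>F \<epsilon> in at_right 0. feas (x + \<epsilon> *\<^sub>R p) (y + \<epsilon> *\<^sub>R q)"
proof -
  have dom: "\<forall>\<^sub>F \<epsilon> in at_right 0. 0 < (x + \<epsilon> *\<^sub>R p) $ i \<or> (x + \<epsilon> *\<^sub>R p) $ i = 0 \<and> (y + \<epsilon> *\<^sub>R q) $ i = 0"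
    for i
  proof (cases "x $ i = 0")
    case True
    then have "0 < p $ i \<or> p $ i = 0 \<and> q $ i = 0" "y $ i = 0"
      using assms by (auto simp: feas_dir_def feas_def in_dom_def) (metis less_irrefl)
    with True show ?thesis
      using eventually_at_right_less[of "0::real"] by (auto elim!: eventually_mono)
  next
    case False
    then have "0 < x $ i" using assms by (auto simp: feas_def in_dom_def)
    have "((\<lambda>\<epsilon>. x $ i + \<epsilon> * p $ i) \<longlongrightarrow> x $ i + 0 * p $ i) (at_right 0)" by (intro tendsto_intros)
    then have "\<forall>\<^sub>F \<epsilon> in at_right 0. 0 < x $ i + \<epsilon> * p $ i"
      by (rule order_tendstoD) (use \<open>0 < x $ i\<close> in simp)
    then show ?thesis by (rule eventually_mono) simp
  qed
  have rowA: "\<forall>\<^sub>F \<epsilon> in at_right 0. (A *v (y + \<epsilon> *\<^sub>R q)) $ k \<le> b $ k" for k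
  proof -
    have "(A *v y) $ k \<le> b $ k" using assms by (auto simp: feas_def less_eq_vec_def)
    then have "\<forall>\<^sub>F \<epsilon> in at_right 0. 0 \<le> (b $ k - (A *v y) $ k) + \<epsilon> * (- (A *v q) $ k)"
      using assms(2) by (intro eventually_pos_step) (auto simp: feas_dir_def)
    then show ?thesis
      by (rule eventually_mono) (simp add: matrix_vector_right_distrib matrix_vector_mult_scaleR)
  qed
  have rowC: "\<forall>\<^sub>F \<epsilon> in at_right 0. (C *v (y + \<epsilon> *\<^sub>R q)) $ k \<le> (D *v (x + \<epsilon> *\<^sub>R p)) $ k" for k
  proof -
    have "(C *v y) $ k \<le> (D *v x) $ k" using assms by (auto simp: feas_def less_eq_vec_def)
    then have "\<forall>\<^sub>F \<epsilon> in at_right 0. 0 \<le> ((D *v x) $ k - (C *v y) $ k) + \<epsilon> * ((D *v p) $ k - (C *v q) $ k)"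
      using assms(2) by (intro eventually_pos_step) (auto simp: feas_dir_def)
    then show ?thesis
      by (rule eventually_mono)
        (simp add: matrix_vector_right_distrib matrix_vector_mult_scaleR algebra_simps)
  qed
  show ?thesis
    unfolding feas_def in_dom_def less_eq_vec_def
    by (intro eventually_conj eventually_all_finite dom rowA rowC)
qed

text \<open>\<open>\<tau>\<close> is \<open>t \<bullet> p\<close> when a subgradient is tested, and
  0 when only \<open>y\<close> varies. A derivative below \<open>\<tau>\<close> would violate
  minimality at some small feasible step.\<close>

lemma first_order:
  assumes fs: "feas x y" and dir: "feas_dir x y p q"
    and min: "\<And>\<epsilon>. 0 < \<epsilon> \<Longrightarrow> feas (x + \<epsilon> *\<^sub>R p) (y + \<epsilon> *\<^sub>R q)
      \<Longrightarrow> val x y + \<epsilon> * \<tau> \<le> val (x + \<epsilon> *\<^sub>R p) (y + \<epsilon> *\<^sub>R q)"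
  shows "\<tau> \<le> 2 * (q \<bullet> (R *v y)) + (\<Sum>i\<in>UNIV. if x $ i = 0 then \<delta> $ i * (q $ i)\<^sup>2 / p $ i
        else \<delta> $ i * (2 * (y $ i / x $ i) * q $ i - (y $ i)\<^sup>2 / (x $ i)\<^sup>2 * p $ i))
      + g \<bullet> q + h \<bullet> p" (is "\<tau> \<le> ?d")
proof (rule ccontr)
  assume "\<not> \<tau> \<le> ?d"
  then have neg: "?d - \<tau> < 0" by simp
  have "x $ i = 0 \<Longrightarrow> y $ i = 0" for i using fs by (auto simp: feas_def in_dom_def) (metis less_irrefl)
  then have "((\<lambda>\<epsilon>. val (x + \<epsilon> *\<^sub>R p) (y + \<epsilon> *\<^sub>R q) - \<epsilon> * \<tau>) has_real_derivative ?d - \<tau>) (at 0)"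
    by (intro DERIV_diff val_deriv) (auto intro!: derivative_eq_intros)
  from DERIV_neg_dec_right[OF this neg] obtain r where r: "0 < r"
    "\<forall>\<epsilon>>0. \<epsilon> < r \<longrightarrow> val (x + \<epsilon> *\<^sub>R p) (y + \<epsilon> *\<^sub>R q) - \<epsilon> * \<tau> < val x y" by auto
  have "\<forall>\<^sub>F \<epsilon> in at_right 0. \<epsilon> < r \<and> 0 < \<epsilon>"
    using r(1) by (auto simp: eventually_at_right_field)
  then have "\<forall>\<^sub>F \<epsilon> in at_right 0. \<epsilon> < r \<and> 0 < \<epsilon> \<and> feas (x + \<epsilon> *\<^sub>R p) (y + \<epsilon> *\<^sub>R q)"
    using eventually_feas[OF fs dir] by eventually_elim auto
  then obtain \<epsilon> where "\<epsilon> < r" "0 < \<epsilon>" "feas (x + \<epsilon> *\<^sub>R p) (y + \<epsilon> *\<^sub>R q)"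
    using eventually_happens'[OF trivial_limit_at_right_real] by blast
  with r(2) min[of \<epsilon>] show False by force
qed

section \<open>Optimality conditions and affine minorants\<close>

text \<open>Stationarity is confined to the support: the other entries of \<open>y\<close> are no
  variables of the reduced program, and their residuals are what \<Psi> has to match.\<close>

definition kkt :: "real^'n \<Rightarrow> real^'n \<Rightarrow> real^'m1 \<Rightarrow> real^'m2 \<Rightarrow> bool" where
  "kkt x y l m \<longleftrightarrow> feas x y \<and> 0 \<le> l \<and> 0 \<le> m
     \<and> l \<bullet> (A *v y - b) = 0 \<and> m \<bullet> (C *v y - D *v x) = 0
     \<and> (\<forall>i\<in>supp x. 2 * (R *v y) $ i + 2 * \<delta> $ i * (y $ i / x $ i) + g $ i
          + l \<bullet> column i A + m \<bullet> column i C = 0)"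

text \<open>The alternative \<open>z $ i = 0\<close> makes the condition off the support vacuous for \<open>z = x\<close>, where the
  statement becomes the optimality of \<open>y\<close> for the Lagrangian.\<close>

lemma kkt_lagrangian_lower:
  assumes K: "kkt x y l m" and zw: "in_dom z w"
    and tS: "\<And>i. i \<in> supp x \<Longrightarrow> t $ i = - \<delta> $ i * (y $ i)\<^sup>2 / (x $ i)\<^sup>2 - m \<bullet> column i D + h $ i"
    and tN: "\<And>i. i \<notin> supp x \<Longrightarrow> z $ i = 0 \<or>
        \<delta> $ i * \<Psi> $ i = - (2 * (R *v y) $ i + g $ i + l \<bullet> column i A + m \<bullet> column i C) \<and>
        t $ i \<le> - (1 / 4) * \<delta> $ i * (\<Psi> $ i)\<^sup>2 - m \<bullet> column i D + h $ i"
  shows "val x y + t \<bullet> (z - x) \<le> val z w + l \<bullet> (A *v w - b) + m \<bullet> (C *v w - D *v z)"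
proof -
  have fxy: "feas x y" and cs: "l \<bullet> (A *v y - b) = 0" "m \<bullet> (C *v y - D *v x) = 0"
    using K by (auto simp: kkt_def)
  have "l \<bullet> (A *v w - b) + m \<bullet> (C *v w - D *v z)
      = l \<bullet> (A *v (w - y)) + m \<bullet> (C *v (w - y)) - m \<bullet> (D *v (z - x))"
    using cs by (simp add: matrix_vector_mult_diff_distrib inner_diff_right)
  then have pen: "l \<bullet> (A *v w - b) + m \<bullet> (C *v w - D *v z)
      = (\<Sum>i\<in>UNIV. (l \<bullet> column i A) * (w - y) $ i) + (\<Sum>i\<in>UNIV. (m \<bullet> column i C) * (w - y) $ i)
      - (\<Sum>i\<in>UNIV. (m \<bullet> column i D) * (z - x) $ i)"
    by (simp only: inner_matrix_vector_columns)
  \<comment> \<open>With the quadratic form replaced by its tangent at \<open>y\<close>, the gap is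
    a sum over coordinates, and each summand is nonnegative separately.\<close>
  have "0 \<le> (\<Sum>i\<in>UNIV. 2 * ((w - y) $ i * (R *v y) $ i)
      + (\<delta> $ i * (w $ i)\<^sup>2 / z $ i - \<delta> $ i * (y $ i)\<^sup>2 / x $ i)
      + g $ i * (w - y) $ i + h $ i * (z - x) $ i - t $ i * (z - x) $ i
      + (l \<bullet> column i A) * (w - y) $ i + (m \<bullet> column i C) * (w - y) $ i
      - (m \<bullet> column i D) * (z - x) $ i)" (is "0 \<le> sum ?T UNIV")
  proof (rule sum_nonneg)
    fix i
    have zi: "0 < z $ i \<or> z $ i = 0 \<and> w $ i = 0" using zw by (auto simp: in_dom_def)
    show "0 \<le> ?T i"
    proof (cases "x $ i = 0")
      case True
      then have yi: "y $ i = 0" and S: "i \<notin> supp x"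
        using fxy by (auto simp: feas_def in_dom_def supp_def) (metis less_irrefl)
      show ?thesis
      proof (cases "z $ i = 0")
        case z0: True
        then show ?thesis using zi True yi by simp
      next
        case zn: False
        then have z: "0 < z $ i" using zi by simp
        have s: "\<delta> $ i * \<Psi> $ i = - (2 * (R *v y) $ i + g $ i + l \<bullet> column i A + m \<bullet> column i C)"
          and t: "t $ i \<le> - (1 / 4) * \<delta> $ i * (\<Psi> $ i)\<^sup>2 - m \<bullet> column i D + h $ i"
          using tN[OF S] zn by auto
        have "?T i = - (\<delta> $ i * \<Psi> $ i) * w $ i + \<delta> $ i * (w $ i)\<^sup>2 / z $ i
            + (h $ i - t $ i - m \<bullet> column i D) * z $ i"
          unfolding s using True yi by (simp add: algebra_simps)
        moreover have "(1 / 4 * \<delta> $ i * (\<Psi> $ i)\<^sup>2) * z $ i \<le> (h $ i - t $ i - m \<bullet> column i D) * z $ i"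
          by (rule mult_right_mono) (use t zi in auto)
        moreover have "0 \<le> - (\<delta> $ i * \<Psi> $ i) * w $ i + \<delta> $ i * (w $ i)\<^sup>2 / z $ i
            + (1 / 4 * \<delta> $ i * (\<Psi> $ i)\<^sup>2) * z $ i"
        proof -
          \<comment> \<open>Half of \<Psi> is the ratio w / z at which the perspective touches its
            linear minorant; this completes the square.\<close>
          have "- (\<delta> $ i * \<Psi> $ i) * w $ i + \<delta> $ i * (w $ i)\<^sup>2 / z $ i
            + (1 / 4 * \<delta> $ i * (\<Psi> $ i)\<^sup>2) * z $ i = \<delta> $ i * (w $ i - \<Psi> $ i * z $ i / 2)\<^sup>2 / z $ i"
            using z by (simp add: field_simps power2_eq_square)
          then show ?thesis using \<delta>[of i] z by simp
        qed
        ultimately show ?thesis by linarith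
      qed
    next
      case False
      then have xi: "0 < x $ i" and S: "i \<in> supp x" using fxy by (auto simp: feas_def in_dom_def supp_def)
      have s: "2 * (R *v y) $ i = - (2 * \<delta> $ i * (y $ i / x $ i) + g $ i
          + l \<bullet> column i A + m \<bullet> column i C)"
        using K S unfolding kkt_def by fastforce
      have t: "t $ i = - \<delta> $ i * (y $ i)\<^sup>2 / (x $ i)\<^sup>2 - m \<bullet> column i D + h $ i"
        using tS[OF S] .
      have "?T i = (2 * (R *v y) $ i) * (w - y) $ i + (\<delta> $ i * (w $ i)\<^sup>2 / z $ i - \<delta> $ i * (y $ i)\<^sup>2 / x $ i)
          + (g $ i + l \<bullet> column i A + m \<bullet> column i C) * (w - y) $ i
          + (h $ i - t $ i - m \<bullet> column i D) * (z - x) $ i"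
        by (simp add: algebra_simps)
      also have "\<dots> = \<delta> $ i * (w $ i)\<^sup>2 / z $ i - \<delta> $ i * (2 * (y $ i / x $ i) * w $ i - (y $ i / x $ i)\<^sup>2 * z $ i)"
        unfolding s t using xi by (simp add: field_simps power2_eq_square)
      finally have eq: "?T i = \<dots>" .
      show ?thesis
        using zi
      proof
        assume z: "0 < z $ i"
        \<comment> \<open>The perspective minus its tangent plane at the entries of \<open>x\<close>
          and \<open>y\<close>: a square that vanishes when w / z equals y / x.\<close>
        have "?T i = \<delta> $ i * (w $ i - (y $ i / x $ i) * z $ i)\<^sup>2 / z $ i"
          unfolding eq using z xi by (simp add: field_simps power2_eq_square)
        then show ?thesis using \<delta>[of i] z by simp
      next
        assume "z $ i = 0 \<and> w $ i = 0"
        then show ?thesis unfolding eq by simp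
      qed
    qed
  qed
  also have "\<dots> = 2 * ((w - y) \<bullet> (R *v y))
     + ((\<Sum>i\<in>UNIV. \<delta> $ i * (w $ i)\<^sup>2 / z $ i) - (\<Sum>i\<in>UNIV. \<delta> $ i * (y $ i)\<^sup>2 / x $ i))
     + g \<bullet> (w - y) + h \<bullet> (z - x) - t \<bullet> (z - x)
     + ((\<Sum>i\<in>UNIV. (l \<bullet> column i A) * (w - y) $ i) + (\<Sum>i\<in>UNIV. (m \<bullet> column i C) * (w - y) $ i)
      - (\<Sum>i\<in>UNIV. (m \<bullet> column i D) * (z - x) $ i))"
    by (simp only: sum.distrib sum_subtractf sum_distrib_left[symmetric] inner_vec_def inner_real_def)
  finally show ?thesis
    using pen quadratic_lower[of y w] unfolding val_def
    by (simp add: inner_diff_right)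
qed

lemma kkt_subgradient:
  assumes K: "kkt x y l m" and sys: "subgradient_system R \<delta> g h A C D x y l m t \<Psi>"
    and zw: "feas z w"
  shows "val x y + t \<bullet> (z - x) \<le> val z w"
proof -
  have "val x y + t \<bullet> (z - x) \<le> val z w + l \<bullet> (A *v w - b) + m \<bullet> (C *v w - D *v z)"
    by (rule kkt_lagrangian_lower[where \<Psi> = \<Psi>])
      (use assms in \<open>auto simp: subgradient_system_def column_R feas_def\<close>)
  moreover have "l \<bullet> (A *v w - b) \<le> 0" "m \<bullet> (C *v w - D *v z) \<le> 0"
    using zw K by (auto intro!: inner_vec_nonpos simp: feas_def kkt_def)
  ultimately show ?thesis by simp
qed

section \<open>Multipliers from minimality\<close>

lemma multipliers:
  assumes fs: "feas x y"
    and sub: "\<And>z w. feas z w \<Longrightarrow> val x y + t \<bullet> (z - x) \<le> val z w"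
    and qual: "\<And>i. \<delta> $ i = 0 \<Longrightarrow> \<exists>z w. feas z w \<and> 0 < z $ i"
  shows "\<exists>l m \<Psi>. kkt x y l m \<and> subgradient_system R \<delta> g h A C D x y l m t \<Psi>"
proof -
  define P :: "'n \<Rightarrow> (real^'n) \<times> (real^'n)" where "P i = (axis i 1, 0)" for i
  define Q :: "'n \<Rightarrow> (real^'n) \<times> (real^'n)" where "Q i = (0, axis i 1)" for i
  define N where "N = - supp x"
  define IA where "IA = {k. (A *v y) $ k = b $ k}"
  define IC where "IC = {k. (C *v y) $ k = (D *v x) $ k}"
  define fA where "fA k = (0 :: real^'n, row k A)" for k
  define fC where "fC k = (- row k D, row k C)" for k
  \<comment> \<open>The gradient of val - t \<bullet> z in the two vector arguments, without the
    perspective terms at \<open>x $ i = 0\<close>; those enter through the slopes over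
    \<open>N\<close>.\<close>
  define c where "c = ((\<chi> i. h $ i - t $ i - (if x $ i = 0 then 0 else \<delta> $ i * ((y $ i)\<^sup>2 / (x $ i)\<^sup>2))),
      (\<chi> i. 2 * (R *v y) $ i + g $ i + (if x $ i = 0 then 0 else \<delta> $ i * (2 * (y $ i / x $ i)))))"
  have PQ: "P i \<bullet> (p, q) = p $ i" "Q i \<bullet> (p, q) = q $ i" for i p q
    by (simp_all add: P_def Q_def inner_axis')
  have f: "fA k \<bullet> (p, q) = (A *v q) $ k" "fC j \<bullet> (p, q) = (C *v q) $ j - (D *v p) $ j" for k j p q
    by (simp_all add: fA_def fC_def row_inner)
  have "\<exists>w\<in>convex_cone hull (fA ` IA \<union> fC ` IC). c + w \<in> persp_slopes N P Q (\<lambda>i. parabola (\<delta> $ i))"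
  proof (rule persp_cone)
    fix v assume W: "\<And>a. a \<in> fA ` IA \<union> fC ` IC \<Longrightarrow> a \<bullet> v \<le> 0"
      and Nv: "\<And>i. i \<in> N \<Longrightarrow> 0 < P i \<bullet> v \<or> P i \<bullet> v = 0 \<and> Q i \<bullet> v = 0"
    obtain p q where v: "v = (p, q)" by (cases v)
    have dir: "feas_dir x y p q"
      unfolding feas_dir_def
    proof (intro conjI allI impI)
      fix k assume "(A *v y) $ k = b $ k"
      then show "(A *v q) $ k \<le> 0" using W[of "fA k"] by (simp add: IA_def v f)
    next
      fix k assume "(C *v y) $ k = (D *v x) $ k"
      then show "(C *v q) $ k \<le> (D *v p) $ k" using W[of "fC k"] by (simp add: IC_def v f)
    next
      fix i assume "x $ i = 0"
      then show "0 < p $ i \<or> p $ i = 0 \<and> q $ i = 0" using Nv[of i] by (simp add: N_def supp_def v PQ)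
    qed
    have "t \<bullet> p \<le> 2 * (q \<bullet> (R *v y)) + (\<Sum>i\<in>UNIV. if x $ i = 0 then \<delta> $ i * (q $ i)\<^sup>2 / p $ i
        else \<delta> $ i * (2 * (y $ i / x $ i) * q $ i - (y $ i)\<^sup>2 / (x $ i)\<^sup>2 * p $ i))
      + g \<bullet> q + h \<bullet> p"
      by (rule first_order[OF fs dir]) (use sub in fastforce)
    also have "\<dots> = t \<bullet> p + c \<bullet> v + (\<Sum>i\<in>UNIV. if x $ i = 0 then \<delta> $ i * (q $ i)\<^sup>2 / p $ i else 0)"
      unfolding c_def v inner_Pair inner_vec_def inner_real_def sum_distrib_left sum.distrib[symmetric]
      by (rule sum.cong) (auto simp: algebra_simps)
    also have "(\<Sum>i\<in>UNIV. if x $ i = 0 then \<delta> $ i * (q $ i)\<^sup>2 / p $ i else 0)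
        = (\<Sum>i\<in>N. \<delta> $ i * (Q i \<bullet> v)\<^sup>2 / (P i \<bullet> v))"
      by (simp add: sum.If_cases N_def supp_def v PQ Compl_eq)
    finally show "0 \<le> c \<bullet> v + (\<Sum>i\<in>N. \<delta> $ i * (Q i \<bullet> v)\<^sup>2 / (P i \<bullet> v))" by simp
  next
    fix i assume i: "i \<in> N" "\<delta> $ i = 0"
    then obtain z w where zw: "feas z w" "0 < z $ i" using qual by blast
    \<comment> \<open>The direction towards the qualifying point. On \<open>N\<close> the entries of
      \<open>x\<close> and \<open>y\<close> are 0, so there \<open>v\<close> has the entries of
      \<open>z\<close> and \<open>w\<close>, which lie in the domain.\<close>
    define v where "v = (z - x, w - y)"
    have xy0: "x $ j = 0 \<and> y $ j = 0" if "j \<in> N" for j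
      using that fs by (auto simp: N_def supp_def feas_def in_dom_def) (metis less_irrefl)
    have "\<forall>a\<in>fA ` IA \<union> fC ` IC. a \<bullet> v \<le> 0"
      using zw(1) by (auto simp: v_def f feas_def less_eq_vec_def IA_def IC_def
          matrix_vector_mult_diff_distrib)
    moreover have "\<forall>j\<in>N. 0 < P j \<bullet> v \<or> P j \<bullet> v = 0 \<and> Q j \<bullet> v = 0"
      using zw(1) xy0 by (simp add: v_def PQ feas_def in_dom_def)
    moreover have "0 < P i \<bullet> v" using zw(2) xy0[OF i(1)] by (simp add: v_def PQ)
    ultimately show "\<exists>v. (\<forall>a\<in>fA ` IA \<union> fC ` IC. a \<bullet> v \<le> 0) \<and>
        (\<forall>j\<in>N. 0 < P j \<bullet> v \<or> P j \<bullet> v = 0 \<and> Q j \<bullet> v = 0) \<and> 0 < P i \<bullet> v" by blast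
  qed (use \<delta> in auto)
  then obtain wA wC where wA: "wA \<in> convex_cone hull (fA ` IA)" and wC: "wC \<in> convex_cone hull (fC ` IC)"
    and sl: "c + (wA + wC) \<in> persp_slopes N P Q (\<lambda>i. parabola (\<delta> $ i))"
    unfolding convex_cone_hull_Un by auto
  obtain \<nu> where \<nu>: "\<And>k. 0 \<le> \<nu> k" "wA = (\<Sum>k\<in>IA. \<nu> k *\<^sub>R fA k)"
    using convex_cone_hull_image_sum[OF _ wA] by auto
  obtain \<mu> where \<mu>: "\<And>k. 0 \<le> \<mu> k" "wC = (\<Sum>k\<in>IC. \<mu> k *\<^sub>R fC k)"
    using convex_cone_hull_image_sum[OF _ wC] by auto
  obtain s where s: "\<And>i. i \<in> N \<Longrightarrow> s i \<in> parabola (\<delta> $ i)"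
    and cs: "c + (wA + wC) = (\<Sum>i\<in>N. fst (s i) *\<^sub>R P i + snd (s i) *\<^sub>R Q i)"
    using sl by (auto simp: persp_slopes_def)
  define l where "l = (\<chi> k. if k \<in> IA then \<nu> k else 0)"
  define m where "m = (\<chi> k. if k \<in> IC then \<mu> k else 0)"
  have wA': "fst wA = 0" "snd wA $ i = l \<bullet> column i A" for i
    unfolding \<nu>(2) fst_sum snd_sum fA_def l_def sum_row_nth[symmetric] by simp_all
  have "fst wC = - (\<Sum>k\<in>IC. \<mu> k *\<^sub>R row k D)" "snd wC = (\<Sum>k\<in>IC. \<mu> k *\<^sub>R row k C)"
    unfolding \<mu>(2) fst_sum snd_sum fC_def by (simp_all add: sum_negf)
  then have wC': "fst wC $ i = - (m \<bullet> column i D)" "snd wC $ i = m \<bullet> column i C" for i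
    unfolding m_def sum_row_nth[symmetric] by simp_all
  have c1: "h $ i - t $ i - (if x $ i = 0 then 0 else \<delta> $ i * ((y $ i)\<^sup>2 / (x $ i)\<^sup>2)) - m \<bullet> column i D
      = (if i \<in> N then fst (s i) else 0)" for i
    using arg_cong[OF cs, of "\<lambda>u. fst u $ i"] unfolding P_def Q_def fst_axis_sum
    by (simp add: c_def wA' wC')
  have c2: "2 * (R *v y) $ i + g $ i + (if x $ i = 0 then 0 else \<delta> $ i * (2 * (y $ i / x $ i)))
      + l \<bullet> column i A + m \<bullet> column i C = (if i \<in> N then snd (s i) else 0)" for i
    using arg_cong[OF cs, of "\<lambda>u. snd u $ i"] unfolding P_def Q_def fst_axis_sum
    by (simp add: c_def wA' wC')
  have kkt: "kkt x y l m"
    unfolding kkt_def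
  proof (intro conjI ballI)
    show "0 \<le> l" "0 \<le> m" using \<nu> \<mu> by (auto simp: less_eq_vec_def l_def m_def)
    show "l \<bullet> (A *v y - b) = 0" "m \<bullet> (C *v y - D *v x) = 0"
      by (auto simp: inner_vec_def l_def m_def IA_def IC_def intro!: sum.neutral)
    fix i assume "i \<in> supp x"
    then show "2 * (R *v y) $ i + 2 * \<delta> $ i * (y $ i / x $ i) + g $ i
          + l \<bullet> column i A + m \<bullet> column i C = 0"
      using c2[of i] by (simp add: N_def supp_def algebra_simps)
  qed (rule fs)
  \<comment> \<open>\<Psi> rescales the second slope a, so that \<delta> \<Psi>^2 / 4 = a^2 / (4
    \<delta>) is at most the first slope. For \<delta> = 0 the parabola forces a = 0, and the
    default value 0 of the quotient fits.\<close>
  moreover have "subgradient_system R \<delta> g h A C D x y l m t (\<chi> i. - snd (s i) / \<delta> $ i)"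
    unfolding subgradient_system_def
  proof (intro conjI ballI)
    fix i assume "i \<in> supp x"
    then show "t $ i = - \<delta> $ i * (y $ i)\<^sup>2 / (x $ i)\<^sup>2 - m \<bullet> column i D + h $ i"
      using c1[of i] by (simp add: N_def supp_def algebra_simps)
  next
    fix i assume "i \<in> - supp x"
    then have i: "i \<in> N" and x0: "x $ i = 0" by (auto simp: N_def supp_def)
    have par: "0 \<le> fst (s i)" "(snd (s i))\<^sup>2 \<le> 4 * \<delta> $ i * fst (s i)"
      using s[OF i] by (auto simp: parabola_def)
    have e1: "t $ i = - fst (s i) - m \<bullet> column i D + h $ i" using c1[of i] i x0 by simp
    have e2: "snd (s i) = 2 * (column i R \<bullet> y) + g $ i + l \<bullet> column i A + m \<bullet> column i C"
      using c2[of i] i x0 by (simp add: column_R)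
    show "\<delta> $ i * (\<chi> i. - snd (s i) / \<delta> $ i) $ i =
          - (2 * (column i R \<bullet> y) + g $ i + l \<bullet> column i A + m \<bullet> column i C)"
      unfolding e2[symmetric] using par by (cases "\<delta> $ i = 0") auto
    have "1 / 4 * \<delta> $ i * (- snd (s i) / \<delta> $ i)\<^sup>2 \<le> fst (s i)"
    proof (cases "\<delta> $ i = 0")
      case False
      then have "0 < \<delta> $ i" using \<delta>[of i] by simp
      then show ?thesis using par by (simp add: field_simps power2_eq_square)
    qed (use par in simp)
    then show "t $ i \<le> - (1 / 4) * \<delta> $ i * ((\<chi> i. - snd (s i) / \<delta> $ i) $ i)\<^sup>2 - m \<bullet> column i D + h $ i"
      unfolding e1 by simp
  qed
  ultimately show ?thesis by blast
qed

text \<open>With \<open>x\<close> fixed and only support entries of \<open>y\<close> moving, the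
  denominators are constant and the objective is smooth. The constraints are linear, so Farkas'
  lemma on the restricted active rows suffices.\<close>

lemma reduced_multipliers:
  assumes fs: "feas x y" and min: "\<And>w. feas x w \<Longrightarrow> val x y \<le> val x w"
  shows "\<exists>l m. kkt x y l m"
proof -
  define S where "S = supp x"
  define IA where "IA = {k. (A *v y) $ k = b $ k}"
  define IC where "IC = {k. (C *v y) $ k = (D *v x) $ k}"
  define c where "c = (\<chi> i. 2 * (R *v y) $ i + g $ i + (if x $ i = 0 then 0 else \<delta> $ i * (2 * (y $ i / x $ i))))"
  define W where "W = (\<lambda>k. restr S (row k A)) ` IA \<union> (\<lambda>k. restr S (row k C)) ` IC"
  have "- restr S c \<in> convex_cone hull W"
  proof (rule farkas_cone)
    fix v assume W: "\<And>a. a \<in> W \<Longrightarrow> a \<bullet> v \<le> 0"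
    define q where "q = restr S v"
    have row: "restr S (row k M) \<bullet> v = (M *v q) $ k" for k and M :: "real^'n^'k"
      unfolding q_def by (simp add: inner_restr[symmetric] row_inner)
    have dir: "feas_dir x y 0 q"
      unfolding feas_dir_def
    proof (intro conjI allI impI)
      fix k assume "(A *v y) $ k = b $ k"
      then show "(A *v q) $ k \<le> 0" using W[of "restr S (row k A)"] by (simp add: W_def IA_def row)
    next
      fix k assume "(C *v y) $ k = (D *v x) $ k"
      then show "(C *v q) $ k \<le> (D *v 0) $ k"
        using W[of "restr S (row k C)"] by (simp add: W_def IC_def row)
    qed (auto simp: q_def S_def supp_def)
    have "0 \<le> 2 * (q \<bullet> (R *v y)) + (\<Sum>i\<in>UNIV. if x $ i = 0 then \<delta> $ i * (q $ i)\<^sup>2 / 0 $ i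
        else \<delta> $ i * (2 * (y $ i / x $ i) * q $ i - (y $ i)\<^sup>2 / (x $ i)\<^sup>2 * 0 $ i))
      + g \<bullet> q + h \<bullet> 0"
      by (rule first_order[OF fs dir]) (use min in fastforce)
    also have "\<dots> = c \<bullet> q"
      unfolding c_def inner_vec_def inner_real_def sum_distrib_left sum.distrib[symmetric]
      by (rule sum.cong) (auto simp: algebra_simps)
    finally show "0 \<le> restr S c \<bullet> v" by (simp add: q_def inner_restr)
  qed (simp add: W_def)
  then obtain wA wC where wA: "wA \<in> convex_cone hull ((\<lambda>k. restr S (row k A)) ` IA)"
    and wC: "wC \<in> convex_cone hull ((\<lambda>k. restr S (row k C)) ` IC)"
    and cw: "- restr S c = wA + wC"
    unfolding W_def convex_cone_hull_Un by auto
  obtain \<nu> where \<nu>: "\<And>k. 0 \<le> \<nu> k" "wA = (\<Sum>k\<in>IA. \<nu> k *\<^sub>R restr S (row k A))"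
    using convex_cone_hull_image_sum[OF _ wA] by auto
  obtain \<mu> where \<mu>: "\<And>k. 0 \<le> \<mu> k" "wC = (\<Sum>k\<in>IC. \<mu> k *\<^sub>R restr S (row k C))"
    using convex_cone_hull_image_sum[OF _ wC] by auto
  define l where "l = (\<chi> k. if k \<in> IA then \<nu> k else 0)"
  define m where "m = (\<chi> k. if k \<in> IC then \<mu> k else 0)"
  have w: "wA $ i = l \<bullet> column i A" "wC $ i = m \<bullet> column i C" if "i \<in> S" for i
    unfolding \<nu>(2) \<mu>(2) l_def m_def sum_row_nth[symmetric] using that by simp_all
  have "kkt x y l m"
    unfolding kkt_def
  proof (intro conjI ballI)
    show "0 \<le> l" "0 \<le> m" using \<nu> \<mu> by (auto simp: less_eq_vec_def l_def m_def)
    show "l \<bullet> (A *v y - b) = 0" "m \<bullet> (C *v y - D *v x) = 0"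
      by (auto simp: inner_vec_def l_def m_def IA_def IC_def intro!: sum.neutral)
    fix i assume i: "i \<in> supp x"
    then show "2 * (R *v y) $ i + 2 * \<delta> $ i * (y $ i / x $ i) + g $ i
          + l \<bullet> column i A + m \<bullet> column i C = 0"
      using arg_cong[OF cw, of "\<lambda>u. u $ i"] w[of i]
      by (simp add: c_def S_def supp_def algebra_simps)
  qed (rule fs)
  then show ?thesis by blast
qed

text \<open>Gordan's alternative: without a strictly feasible direction, some nonzero pair could be
  added to the multipliers.\<close>

lemma unique_multipliers_direction:
  assumes K: "kkt x y l m" and uniq: "\<And>l' m'. kkt x y l' m' \<Longrightarrow> l' = l \<and> m' = m"
  obtains q where "\<And>k. (A *v y) $ k = b $ k \<Longrightarrow> (A *v q) $ k < 0"
    "\<And>k. (C *v y) $ k = (D *v x) $ k \<Longrightarrow> (C *v q) $ k < 0"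
proof (rule ccontr)
  assume none: "\<not> thesis"
  define S where "S = supp x"
  define IA where "IA = {k. (A *v y) $ k = b $ k}"
  define IC where "IC = {k. (C *v y) $ k = (D *v x) $ k}"
  \<comment> \<open>The extra coordinate measures a common margin r: active rows at most -r with r >
    0 would give a strict direction. If there is none, (0, 1) lies in the cone, so some nonnegative
    coefficients of total weight 1 cancel the restricted rows.\<close>
  define fA where "fA k = (restr S (row k A), 1::real)" for k
  define fC where "fC k = (restr S (row k C), 1::real)" for k
  have "- (0, - 1) \<in> convex_cone hull (fA ` IA \<union> fC ` IC)"
  proof (rule farkas_cone)
    fix v assume W: "\<And>a. a \<in> fA ` IA \<union> fC ` IC \<Longrightarrow> a \<bullet> v \<le> 0"
    obtain d r where v: "v = (d, r)" by (cases v)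
    have "(A *v restr S d) $ k + r \<le> 0" if "k \<in> IA" for k
      using W[of "fA k"] that by (simp add: v fA_def inner_restr[symmetric] row_inner)
    moreover have "(C *v restr S d) $ k + r \<le> 0" if "k \<in> IC" for k
      using W[of "fC k"] that by (simp add: v fC_def inner_restr[symmetric] row_inner)
    ultimately have "\<not> 0 < r" using none that[of "restr S d"] by (fastforce simp: IA_def IC_def)
    then show "0 \<le> (0, - 1) \<bullet> v" by (simp add: v)
  qed simp
  then obtain wA wC where wA: "wA \<in> convex_cone hull (fA ` IA)" and wC: "wC \<in> convex_cone hull (fC ` IC)"
    and cw: "(0, 1) = wA + wC"
    unfolding convex_cone_hull_Un by auto
  obtain \<nu> where \<nu>: "\<And>k. 0 \<le> \<nu> k" "wA = (\<Sum>k\<in>IA. \<nu> k *\<^sub>R fA k)"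
    using convex_cone_hull_image_sum[OF _ wA] by auto
  obtain \<mu> where \<mu>: "\<And>k. 0 \<le> \<mu> k" "wC = (\<Sum>k\<in>IC. \<mu> k *\<^sub>R fC k)"
    using convex_cone_hull_image_sum[OF _ wC] by auto
  define l0 where "l0 = (\<chi> k. if k \<in> IA then \<nu> k else 0)"
  define m0 where "m0 = (\<chi> k. if k \<in> IC then \<mu> k else 0)"
  have w: "fst wA $ i = l0 \<bullet> column i A" "fst wC $ i = m0 \<bullet> column i C" if "i \<in> S" for i
    unfolding \<nu>(2) \<mu>(2) l0_def m0_def sum_row_nth[symmetric] fA_def fC_def fst_sum
    using that by simp_all
  have bal: "l0 \<bullet> column i A + m0 \<bullet> column i C = 0" if "i \<in> S" for i
    using arg_cong[OF cw, of "\<lambda>u. fst u $ i"] w[OF that] by simp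
  have l0: "0 \<le> l0" "0 \<le> m0" "l0 \<bullet> (A *v y - b) = 0" "m0 \<bullet> (C *v y - D *v x) = 0"
    using \<nu> \<mu> by (auto simp: less_eq_vec_def inner_vec_def l0_def m0_def IA_def IC_def intro!: sum.neutral)
  have "kkt x y (l + l0) (m + m0)"
    unfolding kkt_def
  proof (intro conjI ballI)
    fix i assume i: "i \<in> supp x"
    then have "2 * (R *v y) $ i + 2 * \<delta> $ i * (y $ i / x $ i) + g $ i
          + l \<bullet> column i A + m \<bullet> column i C = 0"
      using K unfolding kkt_def by blast
    then show "2 * (R *v y) $ i + 2 * \<delta> $ i * (y $ i / x $ i) + g $ i
          + (l + l0) \<bullet> column i A + (m + m0) \<bullet> column i C = 0"
      using bal[of i] i unfolding inner_add_left S_def by linarith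
  qed (use K l0 in \<open>auto simp: kkt_def inner_add_left\<close>)
  \<comment> \<open>Uniqueness kills the added pair, which contradicts the total weight 1.\<close>
  then have "l0 = 0" "m0 = 0" using uniq[of "l + l0" "m + m0"] by auto
  then have "\<nu> k = 0" if "k \<in> IA" for k
    using that by (auto simp: l0_def vec_eq_iff split: if_splits)
  moreover have "\<mu> k = 0" if "k \<in> IC" for k
    using that \<open>m0 = 0\<close> by (auto simp: m0_def vec_eq_iff split: if_splits)
  ultimately have "wA = 0" "wC = 0" unfolding \<nu>(2) \<mu>(2) by auto
  with cw show False by (simp add: zero_prod_def)
qed

text \<open>All entries of \<open>x\<close> can be raised together: the strict slack of the active
  rows along \<open>q\<close> pays for the change of D x.\<close>

lemma unique_multipliers_slater:
  assumes K: "kkt x y l m" and uniq: "\<And>l' m'. kkt x y l' m' \<Longrightarrow> l' = l \<and> m' = m"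
  shows "\<exists>z w. feas z w \<and> 0 < z $ i"
proof -
  obtain q where q: "\<And>k. (A *v y) $ k = b $ k \<Longrightarrow> (A *v q) $ k < 0"
    "\<And>k. (C *v y) $ k = (D *v x) $ k \<Longrightarrow> (C *v q) $ k < 0"
    using unique_multipliers_direction[OF assms] by blast
  have fs: "feas x y" using K by (simp add: kkt_def)
  \<comment> \<open>The speed \<eta> of the all-ones direction is chosen so small that the strict
    decrease of the active rows of \<open>C\<close> outweighs its effect through
    \<open>D\<close>.\<close>
  have "\<forall>\<^sub>F \<eta> in at_right 0. \<forall>k. (C *v y) $ k = (D *v x) $ k \<longrightarrow> 0 \<le> - (C *v q) $ k + \<eta> * (D *v 1) $ k"
  proof (intro eventually_all_finite)
    fix k
    show "\<forall>\<^sub>F \<eta> in at_right 0. (C *v y) $ k = (D *v x) $ k \<longrightarrow> 0 \<le> - (C *v q) $ k + \<eta> * (D *v 1) $ k"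
      using q(2)[of k] eventually_pos_step[of "- (C *v q) $ k" "(D *v 1) $ k"]
      by (cases "(C *v y) $ k = (D *v x) $ k") auto
  qed
  then have "\<forall>\<^sub>F \<eta> in at_right 0. 0 < \<eta> \<and>
      (\<forall>k. (C *v y) $ k = (D *v x) $ k \<longrightarrow> 0 \<le> - (C *v q) $ k + \<eta> * (D *v 1) $ k)"
    using eventually_at_right_less[of "0::real"] by eventually_elim auto
  then obtain \<eta> where \<eta>: "0 < \<eta>"
    "\<And>k. (C *v y) $ k = (D *v x) $ k \<Longrightarrow> 0 \<le> - (C *v q) $ k + \<eta> * (D *v 1) $ k"
    using eventually_happens'[OF trivial_limit_at_right_real] by blast
  have "feas_dir x y (\<eta> *\<^sub>R 1) q"
    unfolding feas_dir_def using q(1) \<eta>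
    by (force simp: matrix_vector_mult_scaleR less_imp_le)
  from eventually_feas[OF fs this]
  have "\<forall>\<^sub>F \<epsilon> in at_right 0. 0 < \<epsilon> \<and> feas (x + \<epsilon> *\<^sub>R (\<eta> *\<^sub>R 1)) (y + \<epsilon> *\<^sub>R q)"
    using eventually_at_right_less[of "0::real"] by eventually_elim auto
  then obtain \<epsilon> where \<epsilon>: "0 < \<epsilon>" "feas (x + \<epsilon> *\<^sub>R (\<eta> *\<^sub>R 1)) (y + \<epsilon> *\<^sub>R q)"
    using eventually_happens'[OF trivial_limit_at_right_real] by blast
  moreover have "0 \<le> x $ i" using fs by (auto simp: feas_def in_dom_def) (metis less_eq_real_def)
  ultimately show ?thesis using \<eta>(1) by (intro exI conjI) (auto simp: add_nonneg_pos)
qed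

section \<open>The reduced program and its Lagrangian dual\<close>

lemma kkt_imp_primal_dual_optimal:
  assumes K: "kkt x y l m"
  shows "primal_dual_optimal R \<delta> g A b C D x y l m"
proof -
  let ?S = "supp x"
  have fs: "feas x y" and lm: "0 \<le> l" "0 \<le> m" using K by (auto simp: kkt_def)
  have x0: "0 < x $ i \<or> x $ i = 0 \<and> y $ i = 0" for i using fs by (simp add: feas_def in_dom_def)
  have y0: "y $ i = 0" if "i \<notin> ?S" for i using x0[of i] that by (auto simp: supp_def)
  have ry: "restr ?S y = y" using y0 by (rule restr_idem)
  have obj: "red_obj R \<delta> g x v = val x (restr ?S v) - h \<bullet> x" for v
    by (simp add: red_obj_restr val_def)
  have dom: "in_dom x (restr ?S v)" for v using x0 by (auto simp: in_dom_def supp_def)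
  have low: "red_obj R \<delta> g x y \<le> red_lagrangian R \<delta> g A b C D x v l m" for v
  proof -
    \<comment> \<open>Taking z = x multiplies the vector by 0; its entries are chosen only to meet
      the support equation of \<open>kkt_lagrangian_lower\<close>.\<close>
    have "val x y + (\<chi> i. - \<delta> $ i * (y $ i)\<^sup>2 / (x $ i)\<^sup>2 - m \<bullet> column i D + h $ i) \<bullet> (x - x)
      \<le> val x (restr ?S v) + l \<bullet> (A *v restr ?S v - b) + m \<bullet> (C *v restr ?S v - D *v x)"
      by (rule kkt_lagrangian_lower[OF K dom]) (auto simp: supp_def)
    then show ?thesis by (simp add: red_lagrangian_def obj ry sub_mv_restr)
  qed
  have pen: "red_lagrangian R \<delta> g A b C D x v l' m' \<le> red_obj R \<delta> g x v"
    if "red_feasible A b C D x v" "0 \<le> l'" "0 \<le> m'" for v l' m'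
  proof -
    have "l' \<bullet> (sub_mv ?S A v - b) \<le> 0" "m' \<bullet> (sub_mv ?S C v - D *v x) \<le> 0"
      using that by (auto intro!: inner_vec_nonpos simp: red_feasible_def)
    then show ?thesis by (simp add: red_lagrangian_def)
  qed
  have rf: "red_feasible A b C D x y"
    using fs by (simp add: red_feasible_def sub_mv_restr ry feas_def)
  \<comment> \<open>Weak duality at \<open>y\<close> bounds every dual value by the primal one, and
    \<open>low\<close> shows that the multipliers \<open>l\<close> and \<open>m\<close> reach
    it.\<close>
  have "red_dual R \<delta> g A b C D x l' m' \<le> red_dual R \<delta> g A b C D x l m" if "0 \<le> l'" "0 \<le> m'" for l' m'
  proof -
    have "red_dual R \<delta> g A b C D x l' m' \<le> ereal (red_lagrangian R \<delta> g A b C D x y l' m')"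
      unfolding red_dual_def by (rule INF_lower) simp
    also have "\<dots> \<le> ereal (red_obj R \<delta> g x y)" using pen[OF rf that] by simp
    also have "\<dots> \<le> red_dual R \<delta> g A b C D x l m"
      unfolding red_dual_def by (rule INF_greatest) (use low in simp)
    finally show ?thesis .
  qed
  moreover have "red_obj R \<delta> g x y \<le> red_obj R \<delta> g x v" if "red_feasible A b C D x v" for v
    using low[of v] pen[OF that lm] by simp
  ultimately show ?thesis
    unfolding primal_dual_optimal_def using y0 rf lm by blast
qed

text \<open>Dual optimality alone does not say that the gap is zero. Strong duality is supplied by
  auxiliary multipliers from \<open>reduced_multipliers\<close>; zero gap then gives complementary
  slackness, and makes \<open>y\<close> a minimiser of the Lagrangian.\<close>

lemma primal_dual_optimal_imp_kkt:
  assumes x: "\<And>i. 0 \<le> x $ i" and O: "primal_dual_optimal R \<delta> g A b C D x y l m"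
  shows "kkt x y l m"
proof -
  let ?S = "supp x"
  have y0: "y $ i = 0" if "i \<notin> ?S" for i using O that by (simp add: primal_dual_optimal_def)
  have ry: "restr ?S y = y" using y0 by (rule restr_idem)
  have lm: "0 \<le> l" "0 \<le> m" and rf: "red_feasible A b C D x y"
    using O by (auto simp: primal_dual_optimal_def)
  have dom: "in_dom x w \<longleftrightarrow> restr ?S w = w" for w
    using x by (force simp: in_dom_def supp_def vec_eq_iff less_le)
  have rfe: "red_feasible A b C D x w \<longleftrightarrow> feas x w" if "restr ?S w = w" for w
    using that by (simp add: red_feasible_def feas_def dom sub_mv_restr)
  have obj: "red_obj R \<delta> g x w = val x w - h \<bullet> x" if "restr ?S w = w" for w
    by (simp add: red_obj_restr val_def that)
  have fs: "feas x y" using rf rfe[OF ry] by simp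
  have "val x y \<le> val x w" if "feas x w" for w
  proof -
    have "restr ?S w = w" using that dom by (simp add: feas_def)
    with that show ?thesis using O rfe[of w] obj[of w] obj[OF ry]
      unfolding primal_dual_optimal_def by force
  qed
  then obtain l' m' where K': "kkt x y l' m'" using reduced_multipliers[OF fs] by blast
  \<comment> \<open>The auxiliary pair closes the gap, so the optimal pair \<open>l\<close>,
    \<open>m\<close> must do so as well.\<close>
  have "ereal (red_obj R \<delta> g x y) \<le> red_dual R \<delta> g A b C D x l' m'"
    unfolding red_dual_def
  proof (rule INF_greatest)
    fix v
    have "val x y + (\<chi> i. - \<delta> $ i * (y $ i)\<^sup>2 / (x $ i)\<^sup>2 - m' \<bullet> column i D + h $ i) \<bullet> (x - x)
      \<le> val x (restr ?S v) + l' \<bullet> (A *v restr ?S v - b) + m' \<bullet> (C *v restr ?S v - D *v x)"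
      by (rule kkt_lagrangian_lower[OF K']) (auto simp: supp_def dom vec_eq_iff)
    then show "ereal (red_obj R \<delta> g x y) \<le> ereal (red_lagrangian R \<delta> g A b C D x v l' m')"
      by (simp add: red_lagrangian_def red_obj_restr val_def ry sub_mv_restr)
  qed
  also have "\<dots> \<le> red_dual R \<delta> g A b C D x l m"
    using O K' by (simp add: primal_dual_optimal_def kkt_def)
  finally have low: "red_obj R \<delta> g x y \<le> red_lagrangian R \<delta> g A b C D x v l m" for v
    unfolding red_dual_def le_INF_iff by simp
  have "l \<bullet> (A *v y - b) \<le> 0" "m \<bullet> (C *v y - D *v x) \<le> 0"
    using fs lm by (auto intro!: inner_vec_nonpos simp: feas_def)
  moreover have "0 \<le> l \<bullet> (A *v y - b) + m \<bullet> (C *v y - D *v x)"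
    using low[of y] by (simp add: red_lagrangian_def sub_mv_restr ry)
  ultimately have cs: "l \<bullet> (A *v y - b) = 0" "m \<bullet> (C *v y - D *v x) = 0" by linarith+
  have stat: "2 * (R *v y) $ i + 2 * \<delta> $ i * (y $ i / x $ i) + g $ i
          + l \<bullet> column i A + m \<bullet> column i C = 0" if i: "i \<in> ?S" for i
  proof -
    have xi: "x $ i \<noteq> 0" using i by (simp add: supp_def)
    define q :: "real^'n" where "q = axis i 1"
    have rq: "restr ?S (y + \<epsilon> *\<^sub>R q) = y + \<epsilon> *\<^sub>R q" for \<epsilon>
      using y0 i by (auto simp: vec_eq_iff q_def axis_def)
    \<comment> \<open>Up to a constant this is the Lagrangian along a coordinate line of the
      support. Both signs of \<epsilon> are allowed, so the derivative at 0 vanishes.\<close>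
    let ?f = "\<lambda>\<epsilon>. val (x + \<epsilon> *\<^sub>R 0) (y + \<epsilon> *\<^sub>R q) + \<epsilon> * (l \<bullet> column i A + m \<bullet> column i C)"
    have "?f 0 \<le> ?f \<epsilon>" for \<epsilon>
    proof -
      have "l \<bullet> (A *v (y + \<epsilon> *\<^sub>R q) - b) = \<epsilon> * (l \<bullet> column i A)"
        "m \<bullet> (C *v (y + \<epsilon> *\<^sub>R q) - D *v x) = \<epsilon> * (m \<bullet> column i C)"
        using cs by (simp_all add: matrix_vector_right_distrib matrix_vector_mult_scaleR q_def
            matrix_vector_mult_basis inner_diff_right inner_add_right)
      then show ?thesis using low[of "y + \<epsilon> *\<^sub>R q"] obj[OF ry] obj[OF rq[of \<epsilon>]]
        by (simp add: red_lagrangian_def sub_mv_restr rq algebra_simps)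
    qed
    moreover have "(?f has_real_derivative
      (2 * (q \<bullet> (R *v y)) + (\<Sum>j\<in>UNIV. if x $ j = 0 then \<delta> $ j * (q $ j)\<^sup>2 / 0 $ j
        else \<delta> $ j * (2 * (y $ j / x $ j) * q $ j - (y $ j)\<^sup>2 / (x $ j)\<^sup>2 * 0 $ j))
      + g \<bullet> q + h \<bullet> 0) + (l \<bullet> column i A + m \<bullet> column i C)) (at 0)"
      by (intro DERIV_add val_deriv) (use y0 in \<open>auto simp: supp_def intro!: derivative_eq_intros\<close>)
    ultimately have "(2 * (q \<bullet> (R *v y)) + (\<Sum>j\<in>UNIV. if x $ j = 0 then \<delta> $ j * (q $ j)\<^sup>2 / 0 $ j
        else \<delta> $ j * (2 * (y $ j / x $ j) * q $ j - (y $ j)\<^sup>2 / (x $ j)\<^sup>2 * 0 $ j))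
      + g \<bullet> q + h \<bullet> 0) + (l \<bullet> column i A + m \<bullet> column i C) = 0"
      using DERIV_local_min[of ?f _ 0 1] by simp
    moreover have "(\<Sum>j\<in>UNIV. if x $ j = 0 then \<delta> $ j * (q $ j)\<^sup>2 / 0 $ j
        else \<delta> $ j * (2 * (y $ j / x $ j) * q $ j - (y $ j)\<^sup>2 / (x $ j)\<^sup>2 * 0 $ j))
      = (\<Sum>j\<in>UNIV. if j = i then \<delta> $ i * (2 * (y $ i / x $ i)) else 0)"
      by (rule sum.cong) (use xi in \<open>auto simp: q_def axis_def\<close>)
    ultimately show ?thesis by (simp add: q_def inner_axis inner_axis' algebra_simps)
  qed
  show ?thesis unfolding kkt_def by (intro conjI ballI fs lm cs stat)
qed

section \<open>Attainment of the inner infimum\<close>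

lemma attained:
  assumes PD: "pos_definite (diag_mat \<delta> + R)" and x: "\<And>i. 0 \<le> x $ i \<and> x $ i \<le> 1"
    and fs: "feas x w0"
  obtains y where "feas x y" "\<And>w. feas x w \<Longrightarrow> val x y \<le> val x w"
proof -
  obtain c where c: "0 < c" "\<And>v. c * (norm v)\<^sup>2 \<le> v \<bullet> ((diag_mat \<delta> + R) *v v)"
    using pos_definite_coercive[OF PD] by blast
  \<comment> \<open>Dividing by a positive \<open>x $ i \<le> 1\<close> only increases a summand, so
    \<open>val\<close> inherits the coercivity of the form of
    \<open>diag_mat \<delta> + R\<close>.\<close>
  have low: "c * (norm w)\<^sup>2 - norm g * norm w + h \<bullet> x \<le> val x w" if w: "feas x w" for w
  proof -
    have "diag_mat \<delta> *v w = (\<chi> i. \<delta> $ i * w $ i)"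
      by (simp add: diag_mat_def matrix_vector_mult_def vec_eq_iff if_distrib[of "\<lambda>t. t * _"] cong: if_cong)
    then have "w \<bullet> (diag_mat \<delta> *v w) = (\<Sum>i\<in>UNIV. \<delta> $ i * (w $ i)\<^sup>2)"
      by (simp add: inner_vec_def power2_eq_square mult.left_commute)
    then have "w \<bullet> ((diag_mat \<delta> + R) *v w) = (\<Sum>i\<in>UNIV. \<delta> $ i * (w $ i)\<^sup>2) + w \<bullet> (R *v w)"
      by (simp add: matrix_vector_mult_add_rdistrib inner_add_right)
    also have "(\<Sum>i\<in>UNIV. \<delta> $ i * (w $ i)\<^sup>2) \<le> (\<Sum>i\<in>UNIV. \<delta> $ i * (w $ i)\<^sup>2 / x $ i)"
    proof (rule sum_mono)
      fix i
      have nn: "0 \<le> \<delta> $ i * (w $ i)\<^sup>2" using \<delta>[of i] by simp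
      have "0 < x $ i \<or> x $ i = 0 \<and> w $ i = 0" using w by (simp add: feas_def in_dom_def)
      then show "\<delta> $ i * (w $ i)\<^sup>2 \<le> \<delta> $ i * (w $ i)\<^sup>2 / x $ i"
      proof
        assume "0 < x $ i"
        then show ?thesis using x[of i] mult_left_mono[OF _ nn, of "x $ i" 1] by (simp add: le_divide_eq)
      qed simp
    qed
    finally have "c * (norm w)\<^sup>2 \<le> (\<Sum>i\<in>UNIV. \<delta> $ i * (w $ i)\<^sup>2 / x $ i) + w \<bullet> (R *v w)"
      using c(2)[of w] by simp
    moreover have "- (norm g * norm w) \<le> g \<bullet> w" using Cauchy_Schwarz_ineq2[of g w] by linarith
    ultimately show ?thesis by (simp add: val_def)
  qed
  define T where "T = {w. feas x w \<and> val x w \<le> val x w0}"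
  \<comment> \<open>For fixed nonnegative \<open>x\<close> the domain condition reduces to
    equations, which makes the sublevel set closed.\<close>
  have feas_iff: "feas x w \<longleftrightarrow> (\<forall>i. x $ i = 0 \<longrightarrow> w $ i = 0) \<and> (\<forall>k. (A *v w) $ k \<le> b $ k)
      \<and> (\<forall>k. (C *v w) $ k \<le> (D *v x) $ k)" for w
    using x by (force simp: feas_def in_dom_def less_eq_vec_def less_le)
  have cont: "continuous_on UNIV (val x)"
    unfolding val_def divide_inverse
    by (intro continuous_intros matrix_vector_mult_linear_continuous_on)
  have "closed T"
    unfolding T_def feas_iff
    by (intro closed_Collect_conj closed_Collect_all closed_Collect_imp closed_Collect_le closed_Collect_eq
        open_Collect_const continuous_intros matrix_vector_mult_linear_continuous_on
        continuous_on_compose2[OF cont]) auto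
  \<comment> \<open>The summand 1 forces the norm r of a point outside the ball above 1, so K \<le>
    K r and c r^2 > (norm g + K) r contradicts \<open>low\<close>.\<close>
  moreover have "T \<subseteq> cball 0 ((norm g + \<bar>val x w0 - h \<bullet> x\<bar>) / c + 1)"
  proof
    fix w assume w: "w \<in> T"
    define K where "K = \<bar>val x w0 - h \<bullet> x\<bar>"
    have le: "c * (norm w)\<^sup>2 - norm g * norm w \<le> K" using w low[of w] unfolding T_def K_def by (smt (verit) mem_Collect_eq)
    have "norm w \<le> (norm g + K) / c + 1"
    proof (rule ccontr)
      assume "\<not> norm w \<le> (norm g + K) / c + 1"
      then have gt: "(norm g + K) / c + 1 < norm w" by simp
      have K0: "0 \<le> K" by (simp add: K_def)
      then have w1: "1 < norm w" using gt c(1)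
        by (smt (verit) divide_nonneg_pos norm_ge_zero)
      have "norm g + K < c * norm w" using gt c(1)
        by (smt (verit) divide_less_eq mult.commute)
      then have "(norm g + K) * norm w < c * norm w * norm w" using w1 by (intro mult_strict_right_mono) auto
      moreover have "K \<le> K * norm w" using K0 w1 by (simp add: mult_le_cancel_left1)
      ultimately show False using le by (simp add: power2_eq_square algebra_simps)
    qed
    then show "w \<in> cball 0 ((norm g + \<bar>val x w0 - h \<bullet> x\<bar>) / c + 1)" by (simp add: K_def)
  qed
  then have "bounded T" by (rule bounded_subset[OF bounded_cball])
  ultimately have "compact T" by (simp add: compact_eq_bounded_closed)
  moreover have "w0 \<in> T" using fs by (simp add: T_def)
  ultimately obtain y where "y \<in> T" "\<And>w. w \<in> T \<Longrightarrow> val x y \<le> val x w"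
    using continuous_attains_inf[of T "val x"] continuous_on_subset[OF cont] by blast
  then show thesis using that[of y] by (force simp: T_def)
qed

section \<open>Subgradients of the partial infimum\<close>

lemma subgradient_multipliers:
  assumes PD: "pos_definite (diag_mat \<delta> + R)" and x: "\<And>i. 0 \<le> x $ i \<and> x $ i \<le> 1"
    and ne: "feas x0 y0"
    and qual: "\<And>i. \<delta> $ i = 0 \<Longrightarrow> \<exists>z w. feas z w \<and> 0 < z $ i"
    and t: "t \<in> subdifferential (fbar_persp R \<delta> g h A b C D) x"
  shows "\<exists>y l m \<Psi>. kkt x y l m \<and> subgradient_system R \<delta> g h A C D x y l m t \<Psi>"
proof -
  let ?F = "fbar_persp R \<delta> g h A b C D"
  have sub: "?F x + ereal (t \<bullet> (z - x)) \<le> ?F z" for z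
    using t by (simp add: subdifferential_def)
  have "?F x0 < \<infinity>" using ne fbar_less_top by blast
  \<comment> \<open>The subgradient inequality at the feasible \<open>x0\<close> rules out an
    infinite value at \<open>x\<close>, so there is a feasible \<open>y\<close> to start
    from.\<close>
  then have "?F x < \<infinity>" using sub[of x0] by (cases "?F x") auto
  then obtain w0 where "feas x w0" using fbar_less_top by blast
  then obtain y where y: "feas x y" "\<And>w. feas x w \<Longrightarrow> val x y \<le> val x w"
    using attained[OF PD x] by blast
  have "val x y + t \<bullet> (z - x) \<le> val z w" if "feas z w" for z w
  proof -
    have "ereal (val x y + t \<bullet> (z - x)) \<le> ?F x + ereal (t \<bullet> (z - x))"
      using add_right_mono[OF fbar_ge[of x "val x y"], of "ereal (t \<bullet> (z - x))"] y(2) by simp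
    also have "\<dots> \<le> ?F z" by (rule sub)
    also have "\<dots> \<le> ereal (val z w)" by (rule fbar_le[OF that])
    finally show ?thesis by simp
  qed
  then show ?thesis using multipliers[OF y(1)] qual by blast
qed

lemma multipliers_subgradient:
  assumes K: "kkt x y l m" and sys: "subgradient_system R \<delta> g h A C D x y l m t \<Psi>"
  shows "t \<in> subdifferential (fbar_persp R \<delta> g h A b C D) x"
  unfolding subdifferential_def
proof (intro CollectI allI)
  let ?F = "fbar_persp R \<delta> g h A b C D"
  fix z
  have "?F x + ereal (t \<bullet> (z - x)) \<le> ereal (val x y) + ereal (t \<bullet> (z - x))"
    by (intro add_right_mono fbar_le) (use K in \<open>simp add: kkt_def\<close>)
  also have "\<dots> = ereal (val x y + t \<bullet> (z - x))" by simp
  also have "\<dots> \<le> ?F z" by (intro fbar_ge kkt_subgradient[OF K sys])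
  finally show "?F x + ereal (t \<bullet> (z - x)) \<le> ?F z" .
qed

end

theorem proposition1:
  fixes Q R :: "real^'n^'n" and \<delta> g h x :: "real^'n"
    and A :: "real^'n^'m1" and b :: "real^'m1" and C D :: "real^'n^'m2"
    and X :: "(real^'n) set"
  assumes "pos_definite Q"
    and "\<forall>z\<in>X. \<forall>i. z $ i \<in> {0, 1}"
    and "\<exists>x0 y0. miqp_feasible A b C D X x0 y0"
    and "Q = diag_mat \<delta> + R" and "0 \<le> \<delta>" and "pos_semidefinite R"
    and "\<forall>i. 0 \<le> x $ i \<and> x $ i \<le> 1"
  shows
    "(\<forall>y l m t. primal_dual_optimal R \<delta> g A b C D x y l m
        \<and> (\<forall>y' l' m'. primal_dual_optimal R \<delta> g A b C D x y' l' m' \<longrightarrow>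
             y' = y \<and> l' = l \<and> m' = m) \<longrightarrow>
        (t \<in> subdifferential (fbar_persp R \<delta> g h A b C D) x \<longleftrightarrow>
         (\<exists>\<Psi>. subgradient_system R \<delta> g h A C D x y l m t \<Psi>)))
     \<and> (\<forall>y l m t. primal_dual_optimal R \<delta> g A b C D x y l m
        \<and> (\<exists>\<Psi>. subgradient_system R \<delta> g h A C D x y l m t \<Psi>) \<longrightarrow>
        t \<in> subdifferential (fbar_persp R \<delta> g h A b C D) x)
     \<and> ((\<forall>i. \<delta> $ i = 0 \<longrightarrow> (\<exists>z. fbar_persp R \<delta> g h A b C D z < \<infinity> \<and> z $ i > 0)) \<longrightarrow>
        (\<forall>t. t \<in> subdifferential (fbar_persp R \<delta> g h A b C D) x \<longleftrightarrow>
          (\<exists>y l m. primal_dual_optimal R \<delta> g A b C D x y l m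
             \<and> (\<exists>\<Psi>. subgradient_system R \<delta> g h A C D x y l m t \<Psi>))))"
proof -
  interpret persp_qp R \<delta> g h A b C D
    by unfold_locales (use assms(5,6) in \<open>auto simp: less_eq_vec_def\<close>)
  have opt: "primal_dual_optimal R \<delta> g A b C D x y l m \<longleftrightarrow> kkt x y l m" for y l m
    using kkt_imp_primal_dual_optimal primal_dual_optimal_imp_kkt assms(7) by blast
  obtain x0 y0 where f0: "miqp_feasible A b C D X x0 y0" using assms(3) by blast
  \<comment> \<open>For binary \<open>x0\<close> the complementarity y (1 - x) = 0 forces y = 0
    where x = 0, which is the domain condition.\<close>
  have "0 < x0 $ i \<or> x0 $ i = 0 \<and> y0 $ i = 0" for i
  proof -
    have "x0 $ i \<in> {0, 1}" "y0 $ i * (1 - x0 $ i) = 0"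
      using f0 assms(2) unfolding miqp_feasible_def by blast+
    then show ?thesis by auto
  qed
  with f0 have ne: "feas x0 y0"
    by (simp add: miqp_feasible_def feas_def in_dom_def F1_def F2_def)
  have PD: "pos_definite (diag_mat \<delta> + R)" using assms(1,4) by simp
  have x: "0 \<le> x $ i \<and> x $ i \<le> 1" for i using assms(7) by blast
  note forward = subgradient_multipliers[OF PD x ne]
  \<comment> \<open>Uniqueness acts twice: it supplies the qualification, and it identifies the
    multipliers found for \<open>t\<close> with the given ones.\<close>
  have uniq: "\<exists>\<Psi>. subgradient_system R \<delta> g h A C D x y l m t \<Psi>"
    if K: "kkt x y l m" and u: "\<And>y' l' m'. kkt x y' l' m' \<Longrightarrow> y' = y \<and> l' = l \<and> m' = m"
      and t: "t \<in> subdifferential (fbar_persp R \<delta> g h A b C D) x" for y l m t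
  proof -
    have "\<exists>z w. feas z w \<and> 0 < z $ i" for i
      by (rule unique_multipliers_slater[OF K]) (use u in blast)
    then obtain y' l' m' \<Psi> where "kkt x y' l' m'" "subgradient_system R \<delta> g h A C D x y' l' m' t \<Psi>"
      using forward[OF _ t] by blast
    with u show ?thesis by blast
  qed
  have iff: "t \<in> subdifferential (fbar_persp R \<delta> g h A b C D) x \<longleftrightarrow>
      (\<exists>y l m. kkt x y l m \<and> (\<exists>\<Psi>. subgradient_system R \<delta> g h A C D x y l m t \<Psi>))"
    if qual: "\<forall>i. \<delta> $ i = 0 \<longrightarrow> (\<exists>z. (\<exists>w. feas z w) \<and> 0 < z $ i)" for t
  proof
    assume t: "t \<in> subdifferential (fbar_persp R \<delta> g h A b C D) x"
    have "\<exists>z w. feas z w \<and> 0 < z $ i" if "\<delta> $ i = 0" for i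
      using qual that by blast
    from forward[OF this t]
    show "\<exists>y l m. kkt x y l m \<and> (\<exists>\<Psi>. subgradient_system R \<delta> g h A C D x y l m t \<Psi>)" by blast
  qed (use multipliers_subgradient in blast)
  show ?thesis
    unfolding opt fbar_less_top
  proof (intro conjI allI impI)
    fix y l m t
    assume u: "kkt x y l m \<and> (\<forall>y' l' m'. kkt x y' l' m' \<longrightarrow> y' = y \<and> l' = l \<and> m' = m)"
    then have "kkt x y l m" by blast
    with u show "t \<in> subdifferential (fbar_persp R \<delta> g h A b C D) x \<longleftrightarrow>
         (\<exists>\<Psi>. subgradient_system R \<delta> g h A C D x y l m t \<Psi>)"
      using uniq[of y l m t] multipliers_subgradient[of x y l m t] by metis
  qed (use multipliers_subgradient iff in auto)
qed

end
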